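(* Let $K\ge2$, $L\ge2$ and, for $k\in[K]$, let $\{f_{k,\theta}:\theta\in\overline\Theta_k\}$ with $\overline\Theta_k\subset\mathbb R^{e_k}$ be exponential families of densities w.r.t. a $\sigma$-finite measure $\nu$ on $(\mathscr Y,\mathcal Y)$, $f_{k,\theta}(x)=\exp(\langle\eta_k(\theta),T_k(x)\rangle+A_k(\theta)+B_k(x))$, each admitting a countable Hellinger-dense subfamily. Let $\overline\Phi$ be an open convex subset of $O_K^{K+1}\times\overline\Theta_1\times\dots\times\overline\Theta_K$ and for $\phi\in\overline\Phi$ let $P_\phi=p(\cdot;\phi)\cdot\nu^{\otimes L}$ be the associated $L$-marginal HMM distribution (defined in the context). Assume that for all $k\in[K]$: (a) $\theta\mapsto F_{k,\theta}=f_{k,\theta}\cdot\nu$ is continuous on $\overline\Theta_k$ with respect to the Hellinger distance; (b) $\eta_k$ and $A_k$ are of class $\mathcal C^1$ on $\overline\Theta_k$; (c) for all $\theta\in\overline\Theta_k$, $\int\|T_k(x)\|^2f_{k,\theta}(x)\nu(dx)<\infty$ and $\int\|T_k(x)\|^2|f_{k,\theta}(x)-f_{k,\theta'}(x)|\nu(dx)\to0$ as $\|\theta-\theta'\|\to0$. Then the information matrix function $$I(\phi)_{ij}=\int_{\mathscr Y^L}\partial_{\phi_i}p(\mathbf x;\phi)\,\partial_{\phi_j}p(\mathbf x;\phi)\frac{\nu^{\otimes L}(d\mathbf x)}{p(\mathbf x;\phi)}$$ is well-defined and continuous on $\overline\Phi$. Moreover, let $$\Phi^*=\Big\{\overline\phi\in\overline\Phi:\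 I(\overline\phi)\text{ is positive definite and }\inf_{\phi\in\overline\Phi,\ \|\overline\phi-\phi\|\ge a}h^2(P_{\overline\phi},P_\phi)>0\ \ \forall a>0\Big\}.$$ Then for every $\phi^*=(w^*,Q^*,\theta^* )\in\Phi^*$ there is a constant $C(\phi^* )>0$ such that for all $\phi=(w,Q,\theta)\in\overline\Phi$, $$C(\phi^* )\Big[\|w^*-w\|_2^2+\|Q^*-Q\|_2^2+\sum_{k=1}^K\|\theta_k^*-\theta_k\|_2^2\wedge1\Big]\le h^2(P_{\phi^*},P_\phi).$$
   Context: $h$ is the Hellinger distance, $h^2(P,Q)=\frac12\int(\sqrt{dP/d\mu}-\sqrt{dQ/d\mu})^2d\mu$; $[K]=\{1,\dots,K\}$. Exponential families: $\eta_k:\overline\Theta_k\to\mathbb R^{d_k}$ is a function, $T_k:\mathscr Y\to\mathbb R^{d_k}$ and $B_k:\mathscr Y\to\mathbb R$ are measurable with $\int e^{\langle\eta_k(\theta),T_k(x)\rangle+B_k(x)}\nu(dx)<\infty$ for all $\theta\in\overline\Theta_k$, and $A_k(\theta)=-\log\int e^{\langle\eta_k(\theta),T_k(x)\rangle+B_k(x)}\nu(dx)$. $O_K=\{\mathbf a\in(0,1)^{K-1}:a_1+\dots+a_{K-1}<1\}$. A parameter $\phi=(\phi_w,\phi_{Q,1},\dots,\phi_{Q,K},\phi_\theta)\in O_K^{K+1}\times\overline\Theta_1\times\dots\times\overline\Theta_K$ is identified with $(w,Q,\theta)$: $(w_1,\dots,w_{K-1})=\phi_w$ with $w$ a probability vector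 of length $K$; $(Q_{k,1},\dots,Q_{k,K-1})=\phi_{Q,k}$ with $Q$ a $K\times K$ stochastic matrix; $(\theta_1,\dots,\theta_K)=\phi_\theta$. The density is $$p(\mathbf x;\phi)=\sum_{1\le k_1,\dots,k_L\le K}w_{k_1}Q_{k_1,k_2}\cdots Q_{k_{L-1},k_L}\prod_{l=1}^Lf_{k_l,\theta_{k_l}}(x_l),\qquad\mathbf x\in\mathscr Y^L.$$ Openness of $\overline\Phi$ is meant in the ambient Euclidean space. *)

theory Defs
  imports "HOL-Analysis.Analysis"
begin

text \<open>
  For a finite index set \<open>I\<close>, the Euclidean space of dimension \<open>card I\<close> is the set
  \<open>I \<rightarrow>\<^sub>E UNIV\<close> of extensional real functions on \<open>I\<close>, with norm \<^term>\<open>\<lambda>v. L2_set v I\<close>.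
  The library topology on functions (the product topology) restricts to the Euclidean topology on
  this set, so \<^term>\<open>openin (top_of_set (I \<rightarrow>\<^sub>E UNIV))\<close>, \<^const>\<open>continuous_on\<close> and
  \<open>at x within S\<close> have their Euclidean meaning there.
\<close>

abbreviation euc :: "'i set \<Rightarrow> ('i \<Rightarrow> real) set" where
  "euc I \<equiv> I \<rightarrow>\<^sub>E UNIV"

definition euc_dist :: "'i set \<Rightarrow> ('i \<Rightarrow> real) \<Rightarrow> ('i \<Rightarrow> real) \<Rightarrow> real" where
  "euc_dist I x y = L2_set (\<lambda>i. x i - y i) I"

definition euc_convex :: "'i set \<Rightarrow> ('i \<Rightarrow> real) set \<Rightarrow> bool" where
  "euc_convex I S \<longleftrightarrow>
     (\<forall>x\<in>S. \<forall>y\<in>S. \<forall>t\<in>{0..1}. (\<lambda>i\<in>I. (1 - t) * x i + t * y i) \<in> S)"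

text \<open>
  \<open>S\<close> need not be open, so differentiability is relative to \<open>S\<close>: \<open>g\<close> has at every point of \<open>S\<close>
  a Frechet derivative within \<open>S\<close>, with gradient \<open>D\<close> depending continuously on the point.
\<close>

definition euc_C1_on :: "'i set \<Rightarrow> ('i \<Rightarrow> real) set \<Rightarrow> (('i \<Rightarrow> real) \<Rightarrow> real) \<Rightarrow> bool" where
  "euc_C1_on I S g \<longleftrightarrow>
     (\<exists>D :: 'i \<Rightarrow> ('i \<Rightarrow> real) \<Rightarrow> real.
        (\<forall>i\<in>I. continuous_on S (D i)) \<and>
        (\<forall>x\<in>S. ((\<lambda>y. (g y - g x - (\<Sum>i\<in>I. D i x * (y i - x i))) / euc_dist I y x) \<longlongrightarrow> 0)
                  (at x within S)))"

definition partial_deriv :: "(('i \<Rightarrow> real) \<Rightarrow> real) \<Rightarrow> 'i \<Rightarrow> ('i \<Rightarrow> real) \<Rightarrow> real" where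
  "partial_deriv g i x = deriv (\<lambda>t. g (x(i := t))) (x i)"

definition has_partial :: "(('i \<Rightarrow> real) \<Rightarrow> real) \<Rightarrow> 'i \<Rightarrow> ('i \<Rightarrow> real) \<Rightarrow> bool" where
  "has_partial g i x \<longleftrightarrow> (\<lambda>t. g (x(i := t))) differentiable (at (x i))"

definition pos_def_on :: "'i set \<Rightarrow> ('i \<Rightarrow> 'i \<Rightarrow> real) \<Rightarrow> bool" where
  "pos_def_on I M \<longleftrightarrow>
     (\<forall>i\<in>I. \<forall>j\<in>I. M i j = M j i) \<and>
     (\<forall>v. (\<exists>i\<in>I. v i \<noteq> 0) \<longrightarrow> 0 < (\<Sum>i\<in>I. \<Sum>j\<in>I. v i * M i j * v j))"

text \<open>
  The value does not depend on the choice of the sigma-finite measure \<open>\<mu>\<close> dominating \<open>P\<close>, \<open>Q\<close>.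
\<close>

definition hellinger :: "'x measure \<Rightarrow> 'x measure \<Rightarrow> 'x measure \<Rightarrow> real" where
  "hellinger \<mu> P Q =
     sqrt (1 / 2 * (\<integral>x. (sqrt (enn2real (RN_deriv \<mu> P x))
                           - sqrt (enn2real (RN_deriv \<mu> Q x)))\<^sup>2 \<partial>\<mu>))"

text \<open>
  Exponential families on a parameter set in dimension \<open>e\<close> with a statistic of dimension \<open>d\<close>:
  \<open>\<eta> \<theta> j\<close> and \<open>T x j\<close>, for \<open>j < d\<close>, are the coordinates of \<open>\<eta>(\<theta>)\<close> and \<open>T(x)\<close>.
\<close>

definition expfam_kernel ::
  "nat \<Rightarrow> ((nat \<Rightarrow> real) \<Rightarrow> nat \<Rightarrow> real) \<Rightarrow> ('a \<Rightarrow> nat \<Rightarrow> real) \<Rightarrow> ('a \<Rightarrow> real)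
    \<Rightarrow> (nat \<Rightarrow> real) \<Rightarrow> 'a \<Rightarrow> real" where
  "expfam_kernel d \<eta> T B \<theta> x = exp ((\<Sum>j<d. \<eta> \<theta> j * T x j) + B x)"

definition expfam_A ::
  "'a measure \<Rightarrow> nat \<Rightarrow> ((nat \<Rightarrow> real) \<Rightarrow> nat \<Rightarrow> real) \<Rightarrow> ('a \<Rightarrow> nat \<Rightarrow> real) \<Rightarrow> ('a \<Rightarrow> real)
    \<Rightarrow> (nat \<Rightarrow> real) \<Rightarrow> real" where
  "expfam_A \<nu> d \<eta> T B \<theta> = - ln (\<integral>x. expfam_kernel d \<eta> T B \<theta> x \<partial>\<nu>)"

definition expfam_density ::
  "'a measure \<Rightarrow> nat \<Rightarrow> ((nat \<Rightarrow> real) \<Rightarrow> nat \<Rightarrow> real) \<Rightarrow> ('a \<Rightarrow> nat \<Rightarrow> real) \<Rightarrow> ('a \<Rightarrow> real)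
    \<Rightarrow> (nat \<Rightarrow> real) \<Rightarrow> 'a \<Rightarrow> real" where
  "expfam_density \<nu> d \<eta> T B \<theta> x =
     exp ((\<Sum>j<d. \<eta> \<theta> j * T x j) + expfam_A \<nu> d \<eta> T B \<theta> + B x)"

text \<open>
  States are \<open>0, \<dots>, K - 1\<close>. The coordinates of a parameter \<open>\<phi>\<close> are: \<open>Wt j\<close> for \<open>w\<^sub>j\<close> and
  \<open>Tr k j\<close> for \<open>Q\<^sub>k\<^sub>j\<close>, where \<open>j < K - 1\<close> (the last entry of each probability vector being
  determined by the others), and \<open>Th k j\<close> for the \<open>j\<close>-th coordinate of \<open>\<theta>\<^sub>k\<close>, where \<open>j < e k\<close>.
\<close>

datatype hmm_coord = Wt nat | Tr nat nat | Th nat nat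

definition hmm_coords :: "nat \<Rightarrow> (nat \<Rightarrow> nat) \<Rightarrow> hmm_coord set" where
  "hmm_coords K e =
     {Wt j | j. j < K - 1} \<union> {Tr k j | k j. k < K \<and> j < K - 1} \<union> {Th k j | k j. k < K \<and> j < e k}"

definition open_simplex :: "nat \<Rightarrow> (nat \<Rightarrow> real) set" where
  "open_simplex K = {a \<in> {..<K - 1} \<rightarrow>\<^sub>E {0<..<1}. (\<Sum>j<K - 1. a j) < 1}"

definition complete_prob :: "nat \<Rightarrow> (nat \<Rightarrow> real) \<Rightarrow> nat \<Rightarrow> real" where
  "complete_prob K a k = (if k < K - 1 then a k else 1 - (\<Sum>j<K - 1. a j))"

definition hmm_w :: "nat \<Rightarrow> (hmm_coord \<Rightarrow> real) \<Rightarrow> nat \<Rightarrow> real" where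
  "hmm_w K \<phi> = complete_prob K (\<lambda>j. \<phi> (Wt j))"

definition hmm_Q :: "nat \<Rightarrow> (hmm_coord \<Rightarrow> real) \<Rightarrow> nat \<Rightarrow> nat \<Rightarrow> real" where
  "hmm_Q K \<phi> k = complete_prob K (\<lambda>j. \<phi> (Tr k j))"

definition hmm_theta :: "(nat \<Rightarrow> nat) \<Rightarrow> (hmm_coord \<Rightarrow> real) \<Rightarrow> nat \<Rightarrow> nat \<Rightarrow> real" where
  "hmm_theta e \<phi> k = (\<lambda>j\<in>{..<e k}. \<phi> (Th k j))"

definition hmm_params ::
  "nat \<Rightarrow> (nat \<Rightarrow> nat) \<Rightarrow> (nat \<Rightarrow> (nat \<Rightarrow> real) set) \<Rightarrow> (hmm_coord \<Rightarrow> real) set" where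
  "hmm_params K e \<Theta> =
     {\<phi> \<in> euc (hmm_coords K e).
        (\<lambda>j\<in>{..<K - 1}. \<phi> (Wt j)) \<in> open_simplex K \<and>
        (\<forall>k<K. (\<lambda>j\<in>{..<K - 1}. \<phi> (Tr k j)) \<in> open_simplex K) \<and>
        (\<forall>k<K. hmm_theta e \<phi> k \<in> \<Theta> k)}"

definition hmm_density ::
  "nat \<Rightarrow> nat \<Rightarrow> (nat \<Rightarrow> nat) \<Rightarrow> (nat \<Rightarrow> (nat \<Rightarrow> real) \<Rightarrow> 'a \<Rightarrow> real)
    \<Rightarrow> (hmm_coord \<Rightarrow> real) \<Rightarrow> (nat \<Rightarrow> 'a) \<Rightarrow> real" where
  "hmm_density K L e f \<phi> x =
     (\<Sum>s\<in>{..<L} \<rightarrow>\<^sub>E {..<K}.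
        hmm_w K \<phi> (s 0) * (\<Prod>l<L - 1. hmm_Q K \<phi> (s l) (s (Suc l)))
        * (\<Prod>l<L. f (s l) (hmm_theta e \<phi> (s l)) (x l)))"

definition info_integrand ::
  "(('i \<Rightarrow> real) \<Rightarrow> 'x \<Rightarrow> real) \<Rightarrow> ('i \<Rightarrow> real) \<Rightarrow> 'i \<Rightarrow> 'i \<Rightarrow> 'x \<Rightarrow> real" where
  "info_integrand p \<phi> i j x =
     partial_deriv (\<lambda>\<psi>. p \<psi> x) i \<phi> * partial_deriv (\<lambda>\<psi>. p \<psi> x) j \<phi> / p \<phi> x"

definition information ::
  "'x measure \<Rightarrow> (('i \<Rightarrow> real) \<Rightarrow> 'x \<Rightarrow> real) \<Rightarrow> ('i \<Rightarrow> real) \<Rightarrow> 'i \<Rightarrow> 'i \<Rightarrow> real" where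
  "information M p \<phi> i j = (\<integral>x. info_integrand p \<phi> i j x \<partial>M)"

text \<open>
  The infimum is taken in the extended reals, so that it is \<open>\<infinity>\<close> if no parameter of \<open>\<Phi>\<close> is at
  distance at least \<open>a\<close>.
\<close>

definition regular_params ::
  "'i set \<Rightarrow> 'x measure \<Rightarrow> (('i \<Rightarrow> real) \<Rightarrow> 'x \<Rightarrow> real) \<Rightarrow> ('i \<Rightarrow> real) set \<Rightarrow> ('i \<Rightarrow> real) set" where
  "regular_params I M p \<Phi> =
     {\<phi> \<in> \<Phi>.
        pos_def_on I (information M p \<phi>) \<and>
        (\<forall>a>0. (INF \<psi>\<in>{\<psi> \<in> \<Phi>. a \<le> euc_dist I \<phi> \<psi>}.
                   ereal ((hellinger M (density M (p \<phi>)) (density M (p \<psi>)))\<^sup>2)) > 0)}"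

end

theory Submission
  imports Defs
begin

text \<open>
  For a fixed path \<open>s\<close> of hidden states, the summand
  \<open>w\<^sub>s\<^sub>0 \<cdot> \<Prod> Q \<cdot> \<Prod> f\<close> of the density is positive, hence an exponential. Up to a term free of the
  parameter, its logarithm is linear in statistics of the observations: the constant \<open>1\<close>, which carries the logarithms of
  the weights and the normalising terms \<open>A\<close>, and the coordinates of the \<open>T(x\<^sub>l)\<close>. The coefficients
  are \<open>C\<^sup>1\<close> functions of the parameter. The model is thus a finite mixture of exponential components
  \<open>exp(\<Sum>\<^sub>a \<beta>\<^sub>a(\<phi>) \<tau>\<^sub>a(x) + b(x))\<close> (\<open>path_component_eq\<close>), and it is enough to treat such mixtures, in the
  locale \<open>smooth_exponential_mixture\<close>.

  Information matrix. Two applications of the Cauchy-Schwarz inequality, over the components and over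
  the statistics, bound \<open>(\<partial>\<^sub>i p)\<^sup>2 / p\<close> by the sum over the components of
  \<open>|\<partial>\<^sub>i \<beta>|\<^sup>2 \<cdot> component \<cdot> |\<tau>|\<^sup>2\<close> (\<open>p_grad_squared_le\<close>). The integral of this bound is continuous in the
  parameter, because second moments under a product density factorise into the moments
  \<open>\<integral> |T|\<^sup>2 f \<partial>\<nu>\<close>. As the bound moves with the parameter, continuity of the information follows from the
  version of dominated convergence in which the dominating functions converge together with their
  integrals (\<open>integral_tendsto_dominated_by_convergent\<close>).

  Lower bound near \<open>\<phi>\<^sup>*\<close>. If no quadratic bound held, there would be \<open>\<phi>\<^sub>n\<close> at distance \<open>r\<^sub>n\<close> tending to
  \<open>0\<close> from \<open>\<phi>\<^sup>*\<close> with \<open>h\<^sup>2 / r\<^sub>n\<^sup>2\<close> tending to \<open>0\<close> and, by compactness of the sphere, with directions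
  converging to a unit vector \<open>u\<close>. The quotients \<open>(\<surd>p\<^sub>n - \<surd>p\<^sup>*) / r\<^sub>n\<close> then converge pointwise to
  \<open>\<langle>\<nabla>p, u\<rangle> / (2 \<surd>p\<^sup>*)\<close>, so Fatou's lemma forces \<open>\<langle>u, I(\<phi>\<^sup>*) u\<rangle> = 0\<close>, contradicting positive
  definiteness (\<open>quadratic_lower_bound_sqrt_density\<close>).

  Away from \<open>\<phi>\<^sup>*\<close>, the Hellinger distance is bounded below by definition of a regular parameter, while
  the left-hand side is bounded: probabilities lie in the unit interval and the emission terms
  are capped at \<open>1\<close>.
\<close>

section \<open>Differentiation along convergent difference quotients\<close>

text \<open>Countability makes the parameter space metrizable, so that continuity on it can be tested along
  sequences, as dominated convergence requires.\<close>
instance hmm_coord :: countable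
  by countable_datatype

text \<open>Hadamard differentiability at \<open>x\<close> relative to \<open>S\<close>. Increments along a coordinate axis give partial
  derivatives, increments in converging directions give what the local analysis of the Hellinger
  distance needs. Scales \<open>r n\<close> of either sign are admitted, so that partial derivatives are
  two-sided.\<close>

definition hadamard_gradient ::
  "'i set \<Rightarrow> ('i \<Rightarrow> real) set \<Rightarrow> (('i \<Rightarrow> real) \<Rightarrow> real) \<Rightarrow> ('i \<Rightarrow> real) \<Rightarrow> ('i \<Rightarrow> real) \<Rightarrow> bool" where
  "hadamard_gradient I S g x G \<longleftrightarrow>
     (\<forall>y r u. (\<forall>n. y n \<in> S) \<longrightarrow> (\<forall>n. r n \<noteq> 0) \<longrightarrow> r \<longlonglongrightarrow> (0::real) \<longrightarrow>
        (\<forall>i\<in>I. (\<lambda>n. (y n i - x i) / r n) \<longlonglongrightarrow> u i) \<longrightarrow>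
        (\<lambda>n. (g (y n) - g x) / r n) \<longlonglongrightarrow> (\<Sum>i\<in>I. G i * u i))"

lemma hadamard_gradientD:
  assumes "hadamard_gradient I S g x G" "\<And>n. y n \<in> S" "\<And>n. r n \<noteq> 0" "r \<longlonglongrightarrow> (0::real)"
    and "\<And>i. i \<in> I \<Longrightarrow> (\<lambda>n. (y n i - x i) / r n) \<longlonglongrightarrow> u i"
  shows "(\<lambda>n. (g (y n) - g x) / r n) \<longlonglongrightarrow> (\<Sum>i\<in>I. G i * u i)"
  using assms unfolding hadamard_gradient_def by blast

lemma hadamard_gradient_cong:
  assumes "x \<in> S" "\<And>y. y \<in> S \<Longrightarrow> g y = g' y"
  shows "hadamard_gradient I S g x G \<longleftrightarrow> hadamard_gradient I S g' x G"
  using assms unfolding hadamard_gradient_def by (intro iff_allI imp_cong refl) simp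

lemma tendsto_of_difference_quotient:
  fixes a :: "nat \<Rightarrow> real"
  assumes "(\<lambda>n. (a n - l) / r n) \<longlonglongrightarrow> v" "\<And>n. r n \<noteq> 0" "r \<longlonglongrightarrow> 0"
  shows "a \<longlonglongrightarrow> l"
proof -
  have "(\<lambda>n. (a n - l) / r n * r n + l) \<longlonglongrightarrow> v * 0 + l"
    by (intro tendsto_intros assms)
  then show ?thesis using assms(2) by simp
qed

text \<open>The slope function of \<open>h\<close> at \<open>l\<close>, extended by \<open>h'\<close>, is continuous at \<open>l\<close> (Caratheodory), and the
  values \<open>a n\<close> tend to \<open>l\<close> because their difference quotients converge while \<open>r\<close> tends to \<open>0\<close>. Values
  with \<open>a n = l\<close> need no separate treatment this way.\<close>

lemma difference_quotient_chain:
  fixes a :: "nat \<Rightarrow> real"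
  assumes a: "(\<lambda>n. (a n - l) / r n) \<longlonglongrightarrow> v" and r: "\<And>n. r n \<noteq> 0" "r \<longlonglongrightarrow> 0"
    and h: "(h has_real_derivative h') (at l)"
  shows "(\<lambda>n. (h (a n) - h l) / r n) \<longlonglongrightarrow> h' * v"
proof -
  obtain q where q: "\<And>z. h z - h l = q z * (z - l)" "isCont q l" "q l = h'"
    using h unfolding CARAT_DERIV by blast
  have "a \<longlonglongrightarrow> l" using tendsto_of_difference_quotient[OF a r] .
  then have "(\<lambda>n. q (a n)) \<longlonglongrightarrow> h'"
    using q(2,3) isCont_tendsto_compose by blast
  then have "(\<lambda>n. q (a n) * ((a n - l) / r n)) \<longlonglongrightarrow> h' * v"
    by (intro tendsto_mult a)
  then show ?thesis by (simp add: q(1))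
qed

lemma hadamard_gradient_chain:
  assumes "hadamard_gradient I S g x G" "(h has_real_derivative h') (at (g x))"
  shows "hadamard_gradient I S (\<lambda>y. h (g y)) x (\<lambda>i. h' * G i)"
  unfolding hadamard_gradient_def
proof (intro allI impI)
  fix y r u
  assume *: "\<forall>n. y n \<in> S" "\<forall>n. r n \<noteq> 0" "r \<longlonglongrightarrow> (0::real)"
    "\<forall>i\<in>I. (\<lambda>n. (y n i - x i) / r n) \<longlonglongrightarrow> u i"
  have "(\<lambda>n. (g (y n) - g x) / r n) \<longlonglongrightarrow> (\<Sum>i\<in>I. G i * u i)"
    by (rule hadamard_gradientD[OF assms(1)]) (use * in auto)
  then have "(\<lambda>n. (h (g (y n)) - h (g x)) / r n) \<longlonglongrightarrow> h' * (\<Sum>i\<in>I. G i * u i)"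
    by (rule difference_quotient_chain) (use * assms(2) in auto)
  then show "(\<lambda>n. (h (g (y n)) - h (g x)) / r n) \<longlonglongrightarrow> (\<Sum>i\<in>I. h' * G i * u i)"
    by (simp add: sum_distrib_left mult.assoc)
qed

lemma hadamard_gradient_sum:
  assumes "\<And>a. a \<in> A \<Longrightarrow> hadamard_gradient I S (g a) x (G a)"
  shows "hadamard_gradient I S (\<lambda>y. \<Sum>a\<in>A. g a y) x (\<lambda>i. \<Sum>a\<in>A. G a i)"
  unfolding hadamard_gradient_def
proof (intro allI impI)
  fix y r u
  assume *: "\<forall>n. y n \<in> S" "\<forall>n. r n \<noteq> 0" "r \<longlonglongrightarrow> (0::real)"
    "\<forall>i\<in>I. (\<lambda>n. (y n i - x i) / r n) \<longlonglongrightarrow> u i"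
  have "(\<lambda>n. \<Sum>a\<in>A. (g a (y n) - g a x) / r n) \<longlonglongrightarrow> (\<Sum>a\<in>A. \<Sum>i\<in>I. G a i * u i)"
    by (intro tendsto_sum hadamard_gradientD[OF assms]) (use * in auto)
  also have "(\<Sum>a\<in>A. \<Sum>i\<in>I. G a i * u i) = (\<Sum>i\<in>I. (\<Sum>a\<in>A. G a i) * u i)"
    by (subst sum.swap) (simp add: sum_distrib_right)
  finally show "(\<lambda>n. ((\<Sum>a\<in>A. g a (y n)) - (\<Sum>a\<in>A. g a x)) / r n) \<longlonglongrightarrow>
      (\<Sum>i\<in>I. (\<Sum>a\<in>A. G a i) * u i)"
    by (simp add: sum_divide_distrib sum_subtractf diff_divide_distrib)
qed

text \<open>Openness of \<open>S\<close> keeps small increments along the \<open>i\<close>-th axis inside \<open>S\<close>, and these have the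
  \<open>i\<close>-th unit vector as their direction.\<close>

lemma partial_derivative_of_hadamard_gradient:
  assumes fin: "finite I" and opn: "openin (top_of_set (euc I)) S" and x: "x \<in> S" and i: "i \<in> I"
    and g: "hadamard_gradient I S g x G"
  shows "((\<lambda>t. g (x(i := t))) has_real_derivative G i) (at (x i))"
proof -
  define U where "U = {t. x(i := t) \<in> S}"
  have SE: "S \<subseteq> euc I" using openin_imp_subset[OF opn] .
  have "continuous_on UNIV (\<lambda>t. x(i := t))"
  proof (rule continuous_on_coordinatewise_then_product)
    show "continuous_on UNIV (\<lambda>t. (x(i := t)) j)" for j by (cases "j = i") auto
  qed
  moreover have "(\<lambda>t. x(i := t)) \<in> UNIV \<rightarrow> euc I"
    using x SE i by (auto simp: PiE_def extensional_def)
  ultimately have "openin (top_of_set UNIV) (UNIV \<inter> (\<lambda>t. x(i := t)) -` S)"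
    using opn by (rule continuous_openin_preimage)
  then have U: "open U" by (simp add: U_def vimage_def)
  have xU: "x i \<in> U" using x by (simp add: U_def)
  have "((\<lambda>t. (g (x(i := t)) - g (x(i := x i))) / (t - x i)) \<longlongrightarrow> G i) (at (x i) within U)"
    unfolding tendsto_at_iff_sequentially comp_def
  proof (intro allI impI)
    fix X assume X: "\<forall>n. X n \<in> U - {x i}" "X \<longlonglongrightarrow> x i"
    have "(\<lambda>n. (g (x(i := X n)) - g x) / (X n - x i)) \<longlonglongrightarrow> (\<Sum>j\<in>I. G j * (if j = i then 1 else 0))"
    proof (rule hadamard_gradientD[OF g])
      show "x(i := X n) \<in> S" "X n - x i \<noteq> 0" for n using X by (auto simp: U_def)
      show "(\<lambda>n. X n - x i) \<longlonglongrightarrow> 0" using X(2) by (simp add: LIM_zero)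
      show "(\<lambda>n. ((x(i := X n)) j - x j) / (X n - x i)) \<longlonglongrightarrow> (if j = i then 1 else 0)" for j
        using X(1) by (auto simp: eq_diff_eq intro!: tendsto_eventually always_eventually)
    qed
    then show "(\<lambda>n. (g (x(i := X n)) - g (x(i := x i))) / (X n - x i)) \<longlonglongrightarrow> G i"
      using fin i by (simp add: if_distrib cong: if_cong)
  qed
  then have "((\<lambda>t. g (x(i := t))) has_real_derivative G i) (at (x i) within U)"
    unfolding has_field_derivative_iff .
  then show ?thesis using at_within_open[OF xU U] by simp
qed

text \<open>Continuity of \<open>g\<close> is required separately because Hadamard differentiability only speaks of
  sequences whose directions converge.\<close>

definition coord_C1_gradient ::
  "'i set \<Rightarrow> ('i \<Rightarrow> real) set \<Rightarrow> (('i \<Rightarrow> real) \<Rightarrow> real) \<Rightarrow> ('i \<Rightarrow> ('i \<Rightarrow> real) \<Rightarrow> real) \<Rightarrow> bool" where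
  "coord_C1_gradient I S g D \<longleftrightarrow> continuous_on S g \<and> (\<forall>i\<in>I. continuous_on S (D i)) \<and>
     (\<forall>x\<in>S. hadamard_gradient I S g x (\<lambda>i. D i x))"

definition coord_C1 :: "'i set \<Rightarrow> ('i \<Rightarrow> real) set \<Rightarrow> (('i \<Rightarrow> real) \<Rightarrow> real) \<Rightarrow> bool" where
  "coord_C1 I S g \<longleftrightarrow> (\<exists>D. coord_C1_gradient I S g D)"

lemma coord_C1_imp_continuous_on: "coord_C1 I S g \<Longrightarrow> continuous_on S g"
  unfolding coord_C1_def coord_C1_gradient_def by blast

lemma coord_C1_const: "coord_C1 I S (\<lambda>_. c)"
  unfolding coord_C1_def coord_C1_gradient_def hadamard_gradient_def
  by (intro exI[of _ "\<lambda>_ _. 0"]) (auto intro: continuous_intros)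

lemma continuous_on_coordinate: "continuous_on S (\<lambda>y::'i \<Rightarrow> real. y i)"
  using continuous_on_product_coordinates by (rule continuous_on_subset) simp

lemma tendsto_coordinatewise:
  fixes y :: "'b \<Rightarrow> 'i \<Rightarrow> real"
  assumes "\<And>i. ((\<lambda>n. y n i) \<longlongrightarrow> x i) F"
  shows "(y \<longlongrightarrow> x) F"
proof -
  have "limitin (product_topology (\<lambda>_. euclidean) UNIV) y x F"
    using assms by (simp add: limitin_componentwise)
  then show ?thesis by (simp add: euclidean_product_topology)
qed

lemma coord_C1_coordinate:
  assumes "finite I" "i \<in> I"
  shows "coord_C1 I S (\<lambda>y. y i)"
  unfolding coord_C1_def coord_C1_gradient_def hadamard_gradient_def
proof (intro exI[of _ "\<lambda>j _. if j = i then 1 else 0"] conjI ballI allI impI)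
  show "continuous_on S (\<lambda>y::'a \<Rightarrow> real. y i)"
    by (rule continuous_on_coordinate)
  show "continuous_on S (\<lambda>_::'a \<Rightarrow> real. if j = i then 1::real else 0)" for j
    by (rule continuous_on_const)
qed (use assms in \<open>simp add: if_distrib[of "\<lambda>z. z * _"] cong: if_cong\<close>)

lemma coord_C1_chain:
  assumes g: "coord_C1 I S g" and gT: "\<And>y. y \<in> S \<Longrightarrow> g y \<in> T"
    and h: "\<And>z. z \<in> T \<Longrightarrow> (h has_real_derivative h' z) (at z)" and h': "continuous_on T h'"
  shows "coord_C1 I S (\<lambda>y. h (g y))"
proof -
  obtain D where D: "continuous_on S g" "\<And>i. i \<in> I \<Longrightarrow> continuous_on S (D i)"
    "\<And>x. x \<in> S \<Longrightarrow> hadamard_gradient I S g x (\<lambda>i. D i x)"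
    using g unfolding coord_C1_def coord_C1_gradient_def by blast
  have hT: "continuous_on T h"
    using h by (meson DERIV_continuous_on has_field_derivative_at_within)
  show ?thesis unfolding coord_C1_def coord_C1_gradient_def
  proof (intro exI[of _ "\<lambda>i y. h' (g y) * D i y"] conjI ballI)
    show "continuous_on S (\<lambda>y. h (g y))"
      by (rule continuous_on_compose2[OF hT D(1)]) (use gT in auto)
    show "continuous_on S (\<lambda>y. h' (g y) * D i y)" if "i \<in> I" for i
      by (intro continuous_on_mult D(2) that continuous_on_compose2[OF h' D(1)]) (use gT in auto)
    show "hadamard_gradient I S (\<lambda>y. h (g y)) x (\<lambda>i. h' (g x) * D i x)" if "x \<in> S" for x
      by (rule hadamard_gradient_chain[OF D(3)[OF that] h[OF gT[OF that]]])
  qed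
qed

lemma coord_C1_sum:
  assumes "\<And>a. a \<in> A \<Longrightarrow> coord_C1 I S (g a)"
  shows "coord_C1 I S (\<lambda>y. \<Sum>a\<in>A. g a y)"
proof -
  have "\<forall>a\<in>A. \<exists>D. coord_C1_gradient I S (g a) D" using assms unfolding coord_C1_def by blast
  then obtain D where D: "\<And>a. a \<in> A \<Longrightarrow> coord_C1_gradient I S (g a) (D a)" by metis
  have "coord_C1_gradient I S (\<lambda>y. \<Sum>a\<in>A. g a y) (\<lambda>i y. \<Sum>a\<in>A. D a i y)"
    unfolding coord_C1_gradient_def
  proof (intro conjI ballI)
    show "continuous_on S (\<lambda>y. \<Sum>a\<in>A. g a y)"
      using D unfolding coord_C1_gradient_def by (intro continuous_on_sum) blast
    show "continuous_on S (\<lambda>y. \<Sum>a\<in>A. D a i y)" if "i \<in> I" for i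
      using D that unfolding coord_C1_gradient_def by (intro continuous_on_sum) blast
    show "hadamard_gradient I S (\<lambda>y. \<Sum>a\<in>A. g a y) x (\<lambda>i. \<Sum>a\<in>A. D a i x)" if "x \<in> S" for x
      by (rule hadamard_gradient_sum) (use D that in \<open>auto simp: coord_C1_gradient_def\<close>)
  qed
  then show ?thesis unfolding coord_C1_def by blast
qed

lemma coord_C1_add:
  assumes "coord_C1 I S g" "coord_C1 I S h"
  shows "coord_C1 I S (\<lambda>y. g y + h y)"
  using coord_C1_sum[of UNIV I S "\<lambda>b. if b then g else h"] assms by (simp add: UNIV_bool add.commute)

lemma coord_C1_cmult:
  assumes "coord_C1 I S g"
  shows "coord_C1 I S (\<lambda>y. c * g y)"
proof (rule coord_C1_chain[OF assms, where T = UNIV and h' = "\<lambda>_. c"])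
  show "((*) c has_real_derivative c) (at z)" for z by (auto intro!: derivative_eq_intros)
qed auto

lemma coord_C1_ln:
  assumes "coord_C1 I S g" "\<And>y. y \<in> S \<Longrightarrow> 0 < g y"
  shows "coord_C1 I S (\<lambda>y. ln (g y))"
proof (rule coord_C1_chain[OF assms(1), where T = "{0<..}" and h' = inverse])
  show "(ln has_real_derivative inverse z) (at z)" if "z \<in> {0<..}" for z :: real
    using that by (auto intro!: derivative_eq_intros simp: divide_inverse)
  show "continuous_on {0<..} (inverse :: real \<Rightarrow> real)" by (auto intro!: continuous_intros)
qed (use assms(2) in auto)

lemma euc_dist_nonneg: "0 \<le> euc_dist I x y"
  by (simp add: euc_dist_def L2_set_nonneg)

lemma euc_dist_commute: "euc_dist I x y = euc_dist I y x"
  by (simp add: euc_dist_def L2_set_def power2_commute)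

lemma euc_dist_squared: "(euc_dist I x y)\<^sup>2 = (\<Sum>i\<in>I. (x i - y i)\<^sup>2)"
  by (simp add: euc_dist_def L2_set_def sum_nonneg)

lemma euc_dist_eq_0:
  assumes "finite I" "x \<in> euc I" "y \<in> euc I" "euc_dist I x y = 0"
  shows "x = y"
proof -
  have "x i = y i" if "i \<in> I" for i
    using assms that by (simp add: euc_dist_def L2_set_eq_0_iff)
  then show ?thesis using assms(2,3) by (rule PiE_ext[rotated 2])
qed

text \<open>The Frechet remainder, divided by the distance and set to \<open>0\<close> at the base point, is continuous
  there. Along a sequence with convergent difference quotients the distance is at most of the order
  of \<open>\<bar>r n\<bar>\<close>, so the remainder does not contribute to the limit.\<close>

lemma coord_C1_of_euc_C1_on:
  fixes J :: "'i::countable set"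
  assumes fin: "finite J" and S: "S \<subseteq> euc J" and g: "euc_C1_on J S g"
  shows "coord_C1 J S g"
proof -
  obtain D where D: "\<And>i. i \<in> J \<Longrightarrow> continuous_on S (D i)"
    "\<And>x. x \<in> S \<Longrightarrow> ((\<lambda>y. (g y - g x - (\<Sum>i\<in>J. D i x * (y i - x i))) / euc_dist J y x) \<longlongrightarrow> 0)
                  (at x within S)"
    using g unfolding euc_C1_on_def by blast
  \<comment> \<open>by the convention on division by zero, the quotient vanishes at the base point\<close>
  define R where "R x y = (g y - g x - (\<Sum>i\<in>J. D i x * (y i - x i))) / euc_dist J y x" for x y
  have R0: "R x x = 0" for x by (simp add: R_def euc_dist_def)
  have R: "continuous (at x within S) (R x)" if "x \<in> S" for x
    using D(2)[OF that] by (simp add: continuous_within R0 flip: R_def)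
  have expand: "g y = g x + (\<Sum>i\<in>J. D i x * (y i - x i)) + R x y * euc_dist J y x"
    if "x \<in> S" "y \<in> S" for x y
  proof (cases "euc_dist J y x = 0")
    case True
    then have "y = x" using euc_dist_eq_0[OF fin] that S by blast
    then show ?thesis by (simp add: R0)
  qed (simp add: R_def)
  have coord: "((\<lambda>y. y i) \<longlongrightarrow> x i) (at x within S)" for i and x :: "'i \<Rightarrow> real"
    using continuous_on_coordinate[of UNIV i]
    by (metis UNIV_I continuous_on_def tendsto_within_subset subset_UNIV)
  have dist_to_0: "((\<lambda>y. euc_dist J y x) \<longlongrightarrow> 0) (at x within S)" for x
  proof -
    have "((\<lambda>y. sqrt (\<Sum>i\<in>J. (y i - x i)\<^sup>2)) \<longlongrightarrow> sqrt (\<Sum>i\<in>J. (x i - x i)\<^sup>2)) (at x within S)"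
      by (intro tendsto_intros coord)
    then show ?thesis by (simp add: euc_dist_def L2_set_def)
  qed
  have cont: "continuous_on S g"
    unfolding continuous_on_def
  proof
    fix x assume x: "x \<in> S"
    have "((\<lambda>y. g x + (\<Sum>i\<in>J. D i x * (y i - x i)) + R x y * euc_dist J y x) \<longlongrightarrow>
        g x + (\<Sum>i\<in>J. D i x * (x i - x i)) + R x x * 0) (at x within S)"
      by (intro tendsto_intros coord dist_to_0)
        (use R[OF x] in \<open>simp add: continuous_within\<close>)
    moreover have "\<forall>\<^sub>F y in at x within S.
        g x + (\<Sum>i\<in>J. D i x * (y i - x i)) + R x y * euc_dist J y x = g y"
      unfolding eventually_at_filter by (rule always_eventually) (use expand[OF x] in auto)
    ultimately have "(g \<longlongrightarrow> g x + (\<Sum>i\<in>J. D i x * (x i - x i)) + R x x * 0) (at x within S)"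
      by (rule Lim_transform_eventually)
    then show "(g \<longlongrightarrow> g x) (at x within S)" by simp
  qed
  have grad: "hadamard_gradient J S g x (\<lambda>i. D i x)" if x: "x \<in> S" for x
    unfolding hadamard_gradient_def
  proof (intro allI impI)
    fix y r u
    assume y: "\<forall>n. y n \<in> S" and r: "\<forall>n. r n \<noteq> 0" "r \<longlonglongrightarrow> (0::real)"
      and u: "\<forall>i\<in>J. (\<lambda>n. (y n i - x i) / r n) \<longlonglongrightarrow> u i"
    have "y \<longlonglongrightarrow> x"
    proof (rule tendsto_coordinatewise)
      fix i show "(\<lambda>n. y n i) \<longlonglongrightarrow> x i"
      proof (cases "i \<in> J")
        case True
        then show ?thesis using tendsto_of_difference_quotient[of "\<lambda>n. y n i"] u r by blast
      next
        case False
        then have "y n i = x i" for n using y x S by (metis PiE_arb subsetD)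
        then show ?thesis by simp
      qed
    qed
    then have Ry: "(\<lambda>n. R x (y n)) \<longlonglongrightarrow> 0"
      using continuous_within_tendsto_compose'[OF R[OF x], of y sequentially] y R0 by simp
    have "(\<lambda>n. sqrt (\<Sum>i\<in>J. ((y n i - x i) / r n)\<^sup>2)) \<longlonglongrightarrow> sqrt (\<Sum>i\<in>J. (u i)\<^sup>2)"
      using u by (intro tendsto_intros) auto
    moreover have "sqrt (\<Sum>i\<in>J. ((y n i - x i) / r n)\<^sup>2) = euc_dist J (y n) x / \<bar>r n\<bar>" for n
      by (simp add: euc_dist_def L2_set_def power_divide real_sqrt_divide flip: sum_divide_distrib)
    ultimately have E: "(\<lambda>n. euc_dist J (y n) x / \<bar>r n\<bar>) \<longlonglongrightarrow> sqrt (\<Sum>i\<in>J. (u i)\<^sup>2)" by simp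
    have "(\<lambda>n. R x (y n) * (euc_dist J (y n) x / \<bar>r n\<bar>)) \<longlonglongrightarrow> 0 * sqrt (\<Sum>i\<in>J. (u i)\<^sup>2)"
      by (intro tendsto_mult Ry E)
    then have "(\<lambda>n. \<bar>R x (y n) * (euc_dist J (y n) x / \<bar>r n\<bar>)\<bar>) \<longlonglongrightarrow> 0"
      by (simp only: mult_zero_left tendsto_rabs_zero_iff)
    moreover have "\<bar>R x (y n) * (euc_dist J (y n) x / \<bar>r n\<bar>)\<bar> =
        \<bar>R x (y n) * euc_dist J (y n) x / r n\<bar>" for n
      by (simp add: abs_mult)
    ultimately have "(\<lambda>n. R x (y n) * euc_dist J (y n) x / r n) \<longlonglongrightarrow> 0"
      by (simp only: tendsto_rabs_zero_iff)
    then have "(\<lambda>n. (\<Sum>i\<in>J. D i x * ((y n i - x i) / r n)) + R x (y n) * euc_dist J (y n) x / r n)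
        \<longlonglongrightarrow> (\<Sum>i\<in>J. D i x * u i) + 0"
      using u by (intro tendsto_intros) auto
    moreover have "(g (y n) - g x) / r n =
        (\<Sum>i\<in>J. D i x * ((y n i - x i) / r n)) + R x (y n) * euc_dist J (y n) x / r n" for n
      using expand[OF x, of "y n"] y by (simp add: add_divide_distrib sum_divide_distrib)
    ultimately show "(\<lambda>n. (g (y n) - g x) / r n) \<longlonglongrightarrow> (\<Sum>i\<in>J. D i x * u i)" by simp
  qed
  show ?thesis unfolding coord_C1_def coord_C1_gradient_def using cont D(1) grad by blast
qed

text \<open>A function of some of the coordinates, renamed by \<open>\<iota>\<close>, is \<open>C\<^sup>1\<close> as a function of all of them. This
  transfers regularity in \<open>\<theta>\<^sub>k\<close> to regularity in the whole parameter.\<close>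

lemma coord_C1_pullback:
  assumes "finite I" "\<iota> ` J \<subseteq> I" and S: "\<And>y. y \<in> S \<Longrightarrow> (\<lambda>j\<in>J. y (\<iota> j)) \<in> S'"
    and g: "coord_C1 J S' g"
  shows "coord_C1 I S (\<lambda>y. g (\<lambda>j\<in>J. y (\<iota> j)))"
proof -
  let ?\<pi> = "\<lambda>y. \<lambda>j\<in>J. y (\<iota> j)"
  obtain D where D: "continuous_on S' g" "\<And>j. j \<in> J \<Longrightarrow> continuous_on S' (D j)"
    "\<And>x. x \<in> S' \<Longrightarrow> hadamard_gradient J S' g x (\<lambda>j. D j x)"
    using g unfolding coord_C1_def coord_C1_gradient_def by blast
  have \<pi>: "continuous_on S ?\<pi>"
  proof (rule continuous_on_coordinatewise_then_product)
    show "continuous_on S (\<lambda>y. ?\<pi> y j)" for j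
      by (cases "j \<in> J") (auto intro: continuous_on_coordinate)
  qed
  have comp: "continuous_on S (\<lambda>y. h (?\<pi> y))" if "continuous_on S' h" for h :: "_ \<Rightarrow> real"
    by (rule continuous_on_compose2[OF that \<pi>]) (use S in auto)
  show ?thesis unfolding coord_C1_def coord_C1_gradient_def
  proof (intro exI[of _ "\<lambda>i y. \<Sum>j\<in>J. (if i = \<iota> j then 1 else 0) * D j (?\<pi> y)"] conjI ballI)
    show "continuous_on S (\<lambda>y. g (?\<pi> y))" by (rule comp[OF D(1)])
    show "continuous_on S (\<lambda>y. \<Sum>j\<in>J. (if i = \<iota> j then 1 else 0) * D j (?\<pi> y))" for i
      by (intro continuous_on_sum continuous_on_mult continuous_on_const comp D(2))
    show "hadamard_gradient I S (\<lambda>y. g (?\<pi> y)) x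
        (\<lambda>i. \<Sum>j\<in>J. (if i = \<iota> j then 1 else 0) * D j (?\<pi> x))" if x: "x \<in> S" for x
      unfolding hadamard_gradient_def
    proof (intro allI impI)
      fix y r u
      assume *: "\<forall>n. y n \<in> S" "\<forall>n. r n \<noteq> 0" "r \<longlonglongrightarrow> (0::real)"
        "\<forall>i\<in>I. (\<lambda>n. (y n i - x i) / r n) \<longlonglongrightarrow> u i"
      have "(\<lambda>n. (g (?\<pi> (y n)) - g (?\<pi> x)) / r n) \<longlonglongrightarrow> (\<Sum>j\<in>J. D j (?\<pi> x) * u (\<iota> j))"
        by (rule hadamard_gradientD[OF D(3)[OF S[OF x]]]) (use * S assms(2) in auto)
      also have "(\<Sum>j\<in>J. D j (?\<pi> x) * u (\<iota> j)) =
          (\<Sum>j\<in>J. \<Sum>i\<in>I. (if i = \<iota> j then 1 else 0) * D j (?\<pi> x) * u i)"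
        using assms(1,2)
        by (intro sum.cong refl)
          (auto simp: if_distrib[of "\<lambda>z. z * _"] cong: if_cong)
      also have "\<dots> = (\<Sum>i\<in>I. (\<Sum>j\<in>J. (if i = \<iota> j then 1 else 0) * D j (?\<pi> x)) * u i)"
        by (subst sum.swap) (simp add: sum_distrib_right)
      finally show "(\<lambda>n. (g (?\<pi> (y n)) - g (?\<pi> x)) / r n) \<longlonglongrightarrow>
          (\<Sum>i\<in>I. (\<Sum>j\<in>J. (if i = \<iota> j then 1 else 0) * D j (?\<pi> x)) * u i)" .
    qed
  qed
qed

section \<open>Convergence of integrals and the Hellinger distance of densities\<close>

text \<open>Pratt's form of the dominated convergence theorem. By Scheffe's lemma, \<open>g n\<close> tends to \<open>g'\<close> in
  \<open>L\<^sup>1\<close>. Truncating \<open>f n\<close> to the interval from \<open>- g'\<close> to \<open>g'\<close> changes it by at most \<open>\<bar>g n - g'\<bar>\<close>, and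
  the truncated functions are dominated by the single function \<open>g'\<close>.\<close>

lemma integral_tendsto_dominated_by_convergent:
  fixes f :: "nat \<Rightarrow> 'x \<Rightarrow> real"
  assumes f: "\<And>n. f n \<in> borel_measurable M" "f' \<in> borel_measurable M"
    and g: "\<And>n. integrable M (g n)" "integrable M g'"
    and le: "\<And>n x. x \<in> space M \<Longrightarrow> \<bar>f n x\<bar> \<le> g n x"
    and f_lim: "\<And>x. x \<in> space M \<Longrightarrow> (\<lambda>n. f n x) \<longlonglongrightarrow> f' x"
    and g_lim: "\<And>x. x \<in> space M \<Longrightarrow> (\<lambda>n. g n x) \<longlonglongrightarrow> g' x"
    and int_lim: "(\<lambda>n. \<integral>x. g n x \<partial>M) \<longlonglongrightarrow> (\<integral>x. g' x \<partial>M)"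
  shows "(\<lambda>n. \<integral>x. f n x \<partial>M) \<longlonglongrightarrow> (\<integral>x. f' x \<partial>M)"
proof -
  have g_nonneg: "0 \<le> g n x" if "x \<in> space M" for n x using le[OF that, of n] by linarith
  have le': "\<bar>f' x\<bar> \<le> g' x" if "x \<in> space M" for x
    by (rule LIMSEQ_le[OF tendsto_rabs[OF f_lim] g_lim]) (use le that in auto)
  have f_int: "integrable M (f n)" for n
    by (rule Bochner_Integration.integrable_bound[OF g(1)[of n] f(1)]) (use le g_nonneg in force)
  have norm_int: "(\<integral>\<^sup>+x. norm (h x) \<partial>M) = ennreal (\<integral>x. h x \<partial>M)"
    if "integrable M h" "\<And>x. x \<in> space M \<Longrightarrow> 0 \<le> h x" for h :: "'x \<Rightarrow> real"
  proof -
    have "(\<integral>\<^sup>+x. norm (h x) \<partial>M) = (\<integral>\<^sup>+x. h x \<partial>M)"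
      by (intro nn_integral_cong) (use that(2) in auto)
    then show ?thesis using nn_integral_eq_integral[OF that(1)] that(2) by simp
  qed
  have "(\<lambda>n. \<integral>\<^sup>+x. norm (g n x - g' x) \<partial>M) \<longlonglongrightarrow> 0"
  proof (rule Scheffe_lemma1[OF g])
    show "AE x in M. (\<lambda>n. g n x) \<longlonglongrightarrow> g' x" using g_lim by auto
    have "(\<lambda>n. \<integral>\<^sup>+x. norm (g n x) \<partial>M) \<longlonglongrightarrow> (\<integral>\<^sup>+x. norm (g' x) \<partial>M)"
      using int_lim le' g_nonneg
      by (subst (1 2) norm_int) (auto intro!: g tendsto_ennrealI order_trans[OF abs_ge_zero le'])
    then show "limsup (\<lambda>n. \<integral>\<^sup>+x. norm (g n x) \<partial>M) \<le> (\<integral>\<^sup>+x. norm (g' x) \<partial>M)"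
      by (simp add: lim_imp_Limsup)
  qed
  then have "(\<lambda>n. ennreal (\<integral>x. \<bar>g n x - g' x\<bar> \<partial>M)) \<longlonglongrightarrow> ennreal 0"
    using norm_int[of "\<lambda>x. \<bar>g _ x - g' x\<bar>"] g by simp
  then have L1: "(\<lambda>n. \<integral>x. \<bar>g n x - g' x\<bar> \<partial>M) \<longlonglongrightarrow> 0"
    by (subst (asm) tendsto_ennreal_iff) auto
  \<comment> \<open>truncation of the functions at the limit of the bounds\<close>
  define h where "h n x = max (- g' x) (min (f n x) (g' x))" for n x
  have [measurable]: "h n \<in> borel_measurable M" for n
    using f(1) borel_measurable_integrable[OF g(2)] unfolding h_def by measurable
  have h_le: "norm (h n x) \<le> g' x" if "x \<in> space M" for n x
    using le'[OF that] unfolding h_def by auto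
  have h_int: "integrable M (h n)" for n
    by (rule Bochner_Integration.integrable_bound[OF g(2)])
      (auto intro!: AE_I2 order_trans[OF h_le[unfolded real_norm_def]])
  have h_lim: "(\<lambda>n. \<integral>x. h n x \<partial>M) \<longlonglongrightarrow> (\<integral>x. f' x \<partial>M)"
  proof (rule integral_dominated_convergence[where w = g'])
    show "AE x in M. (\<lambda>n. h n x) \<longlonglongrightarrow> f' x"
    proof (rule AE_I2)
      fix x assume x: "x \<in> space M"
      have "(\<lambda>n. h n x) \<longlonglongrightarrow> max (- g' x) (min (f' x) (g' x))"
        unfolding h_def by (intro tendsto_intros f_lim x)
      moreover have "max (- g' x) (min (f' x) (g' x)) = f' x" using le'[OF x] by auto
      ultimately show "(\<lambda>n. h n x) \<longlonglongrightarrow> f' x" by simp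
    qed
  qed (use f g h_le in auto)
  have "norm ((\<integral>x. f n x \<partial>M) - (\<integral>x. h n x \<partial>M)) \<le> (\<integral>x. \<bar>g n x - g' x\<bar> \<partial>M)" for n
  proof -
    have "norm ((\<integral>x. f n x \<partial>M) - (\<integral>x. h n x \<partial>M)) = norm (\<integral>x. f n x - h n x \<partial>M)"
      by (simp add: f_int h_int)
    also have "\<dots> \<le> (\<integral>x. norm (f n x - h n x) \<partial>M)" by (rule integral_norm_bound)
    also have "\<dots> \<le> (\<integral>x. \<bar>g n x - g' x\<bar> \<partial>M)"
    proof (rule integral_mono)
      show "norm (f n x - h n x) \<le> \<bar>g n x - g' x\<bar>" if "x \<in> space M" for x
        using le[OF that, of n] le'[OF that] unfolding h_def by auto
    qed (use f_int h_int g in auto)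
    finally show ?thesis .
  qed
  then have "(\<lambda>n. (\<integral>x. f n x \<partial>M) - (\<integral>x. h n x \<partial>M)) \<longlonglongrightarrow> 0"
    by (intro Lim_null_comparison[OF _ L1]) simp
  from tendsto_add[OF this h_lim] show ?thesis by simp
qed

text \<open>Bolzano-Weierstrass in \<^term>\<open>euc I\<close>, by extracting subsequences one coordinate after the other.\<close>

lemma convergent_subsequence_finite_coordinates:
  fixes X :: "nat \<Rightarrow> 'i \<Rightarrow> real"
  assumes "finite I" "\<And>i. i \<in> I \<Longrightarrow> bounded (range (\<lambda>n. X n i))"
  shows "\<exists>(r::nat \<Rightarrow> nat) u. strict_mono r \<and> (\<forall>i\<in>I. (\<lambda>n. X (r n) i) \<longlonglongrightarrow> u i)"
  using assms
proof (induction I)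
  case empty
  then show ?case using strict_mono_id by auto
next
  case (insert i I)
  then obtain r :: "nat \<Rightarrow> nat" and u where r: "strict_mono r" "\<And>j. j \<in> I \<Longrightarrow> (\<lambda>n. X (r n) j) \<longlonglongrightarrow> u j"
    by auto
  have "bounded (range (\<lambda>n. X (r n) i))"
    by (rule bounded_subset[OF insert.prems[of i]]) auto
  then obtain l and s :: "nat \<Rightarrow> nat" where s: "strict_mono s" "((\<lambda>n. X (r n) i) \<circ> s) \<longlonglongrightarrow> l"
    using bounded_imp_convergent_subsequence by blast
  have "\<forall>j\<in>insert i I. (\<lambda>n. X ((r \<circ> s) n) j) \<longlonglongrightarrow> (u(i := l)) j"
    using s(2) LIMSEQ_subseq_LIMSEQ[OF r(2) s(1)] by (auto simp: comp_def)
  then show ?case using strict_mono_o[OF r(1) s(1)] by blast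
qed

text \<open>By Fatou's lemma the nonnegative limit has integral \<open>0\<close>.\<close>

lemma AE_eq_0_of_fatou:
  fixes q :: "nat \<Rightarrow> 'x \<Rightarrow> real"
  assumes q: "\<And>n. integrable M (q n)" "\<And>n x. x \<in> space M \<Longrightarrow> 0 \<le> q n x"
    and lim: "\<And>x. x \<in> space M \<Longrightarrow> (\<lambda>n. q n x) \<longlonglongrightarrow> q' x"
    and int: "(\<lambda>n. \<integral>x. q n x \<partial>M) \<longlonglongrightarrow> 0" and q': "q' \<in> borel_measurable M"
  shows "AE x in M. q' x = 0"
proof -
  have [measurable]: "q n \<in> borel_measurable M" for n using q(1) by auto
  have nonneg: "0 \<le> q' x" if "x \<in> space M" for x
    by (rule LIMSEQ_le_const[OF lim[OF that]]) (use q(2) that in auto)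
  have "(\<integral>\<^sup>+x. ennreal (q' x) \<partial>M) = (\<integral>\<^sup>+x. liminf (\<lambda>n. ennreal (q n x)) \<partial>M)"
  proof (intro nn_integral_cong)
    fix x assume "x \<in> space M"
    then have "(\<lambda>n. ennreal (q n x)) \<longlonglongrightarrow> ennreal (q' x)" using lim by (intro tendsto_ennrealI)
    then show "ennreal (q' x) = liminf (\<lambda>n. ennreal (q n x))" by (simp add: lim_imp_Liminf)
  qed
  also have "\<dots> \<le> liminf (\<lambda>n. \<integral>\<^sup>+x. ennreal (q n x) \<partial>M)" by (intro nn_integral_liminf) simp
  also have "(\<lambda>n. \<integral>\<^sup>+x. ennreal (q n x) \<partial>M) = (\<lambda>n. ennreal (\<integral>x. q n x \<partial>M))"
    using q by (auto simp: nn_integral_eq_integral)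
  also have "liminf \<dots> = ennreal 0"
    using int by (intro lim_imp_Liminf tendsto_ennrealI) simp_all
  finally have "(\<integral>\<^sup>+x. ennreal (q' x) \<partial>M) = 0" by simp
  then have "AE x in M. ennreal (q' x) = 0" using q' by (subst (asm) nn_integral_0_iff_AE) auto
  then show ?thesis
  proof (rule AE_mp, intro AE_I2 impI)
    fix x assume "x \<in> space M" "ennreal (q' x) = 0"
    then show "q' x = 0" using nonneg[of x] by (simp add: ennreal_eq_0_iff)
  qed
qed

lemma sqrt_diff_squared_integrable:
  fixes p q :: "'x \<Rightarrow> real"
  assumes p: "integrable M p" "\<And>x. x \<in> space M \<Longrightarrow> 0 \<le> p x"
    and q: "integrable M q" "\<And>x. x \<in> space M \<Longrightarrow> 0 \<le> q x"
  shows "integrable M (\<lambda>x. (sqrt (p x) - sqrt (q x))\<^sup>2)"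
proof (rule Bochner_Integration.integrable_bound)
  show "integrable M (\<lambda>x. p x + q x)" using p q by auto
  show "(\<lambda>x. (sqrt (p x) - sqrt (q x))\<^sup>2) \<in> borel_measurable M"
    using borel_measurable_integrable[OF p(1)] borel_measurable_integrable[OF q(1)] by measurable
  show "AE x in M. norm ((sqrt (p x) - sqrt (q x))\<^sup>2) \<le> norm (p x + q x)"
  proof (rule AE_I2)
    fix x assume "x \<in> space M"
    then have "0 \<le> p x" "0 \<le> q x" using p(2) q(2) by auto
    moreover from this have "0 \<le> sqrt (p x) * sqrt (q x)" by simp
    ultimately have "(sqrt (p x) - sqrt (q x))\<^sup>2 \<le> p x + q x" by (simp add: power2_diff)
    then show "norm ((sqrt (p x) - sqrt (q x))\<^sup>2) \<le> norm (p x + q x)"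
      unfolding real_norm_def using zero_le_power2[of "sqrt (p x) - sqrt (q x)"] by linarith
  qed
qed

text \<open>Radon-Nikodym derivatives with respect to a sigma-finite measure are almost everywhere unique.\<close>

lemma hellinger_squared_density:
  fixes p q :: "'x \<Rightarrow> real"
  assumes M: "sigma_finite_measure M"
    and p: "p \<in> borel_measurable M" "\<And>x. x \<in> space M \<Longrightarrow> 0 \<le> p x"
    and q: "q \<in> borel_measurable M" "\<And>x. x \<in> space M \<Longrightarrow> 0 \<le> q x"
  shows "(hellinger M (density M p) (density M q))\<^sup>2 = 1 / 2 * (\<integral>x. (sqrt (p x) - sqrt (q x))\<^sup>2 \<partial>M)"
proof -
  have RN: "AE x in M. enn2real (RN_deriv M (density M f) x) = f x"
    if "f \<in> borel_measurable M" "\<And>x. x \<in> space M \<Longrightarrow> 0 \<le> f x" for f :: "'x \<Rightarrow> real"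
  proof -
    have "AE x in M. ennreal (f x) = RN_deriv M (density M f) x"
      using sigma_finite_measure.RN_deriv_unique[OF M, of "\<lambda>x. ennreal (f x)"] that(1) by simp
    then show ?thesis
    proof (rule AE_mp, intro AE_I2 impI)
      fix x assume "x \<in> space M" "ennreal (f x) = RN_deriv M (density M f) x"
      then show "enn2real (RN_deriv M (density M f) x) = f x"
        using that(2)[of x] by (metis enn2real_ennreal)
    qed
  qed
  have "(\<integral>x. (sqrt (enn2real (RN_deriv M (density M p) x))
               - sqrt (enn2real (RN_deriv M (density M q) x)))\<^sup>2 \<partial>M)
      = (\<integral>x. (sqrt (p x) - sqrt (q x))\<^sup>2 \<partial>M)"
  proof (rule integral_cong_AE)
    show "AE x in M. (sqrt (enn2real (RN_deriv M (density M p) x))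
               - sqrt (enn2real (RN_deriv M (density M q) x)))\<^sup>2 = (sqrt (p x) - sqrt (q x))\<^sup>2"
    proof (rule AE_mp[OF RN[OF p] AE_mp[OF RN[OF q]]])
      show "AE x in M. enn2real (RN_deriv M (density M q) x) = q x \<longrightarrow>
          enn2real (RN_deriv M (density M p) x) = p x \<longrightarrow>
          (sqrt (enn2real (RN_deriv M (density M p) x))
               - sqrt (enn2real (RN_deriv M (density M q) x)))\<^sup>2 = (sqrt (p x) - sqrt (q x))\<^sup>2"
        by simp
    qed
  qed (use p q in measurable)
  then show ?thesis by (simp add: hellinger_def)
qed

lemma euc_dist_ge_coordinate:
  assumes "finite I" "i \<in> I"
  shows "\<bar>x i - y i\<bar> \<le> euc_dist I x y"
  using member_le_L2_set[OF assms, of "\<lambda>i. \<bar>x i - y i\<bar>"] by (simp add: euc_dist_def L2_set_def)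

text \<open>A violating sequence has a subsequence with convergent directions, along which the difference
  quotients of the square roots of the densities converge pointwise. Fatou's lemma passes this to
  their squared norms as a one-sided inequality, the one that a lower bound asks for.\<close>

lemma quadratic_lower_bound_sqrt_density:
  fixes p :: "('i \<Rightarrow> real) \<Rightarrow> 'x \<Rightarrow> real"
  assumes fin: "finite I" and x0: "\<phi>0 \<in> \<Phi>"
    and p_int: "\<And>\<phi>. \<phi> \<in> \<Phi> \<Longrightarrow> integrable M (p \<phi>)"
    and p_nonneg: "\<And>\<phi> x. \<phi> \<in> \<Phi> \<Longrightarrow> x \<in> space M \<Longrightarrow> 0 \<le> p \<phi> x"
    and p_pos: "\<And>x. x \<in> space M \<Longrightarrow> 0 < p \<phi>0 x"
    and grad: "\<And>x. x \<in> space M \<Longrightarrow> hadamard_gradient I \<Phi> (\<lambda>\<phi>. p \<phi> x) \<phi>0 (\<lambda>i. D i x)"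
    and D_meas: "\<And>i. i \<in> I \<Longrightarrow> D i \<in> borel_measurable M"
    and info_int: "\<And>i j. i \<in> I \<Longrightarrow> j \<in> I \<Longrightarrow> integrable M (\<lambda>x. D i x * D j x / p \<phi>0 x)"
    and posdef: "pos_def_on I (\<lambda>i j. \<integral>x. D i x * D j x / p \<phi>0 x \<partial>M)"
  shows "\<exists>\<delta>>0. \<exists>c>0. \<forall>\<phi>\<in>\<Phi>. euc_dist I \<phi>0 \<phi> < \<delta> \<longrightarrow>
           c * (euc_dist I \<phi>0 \<phi>)\<^sup>2 \<le> (\<integral>x. (sqrt (p \<phi>0 x) - sqrt (p \<phi> x))\<^sup>2 \<partial>M)"
proof (rule ccontr)
  define H where "H \<phi> = (\<integral>x. (sqrt (p \<phi>0 x) - sqrt (p \<phi> x))\<^sup>2 \<partial>M)" for \<phi>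
  assume neg: "\<not> ?thesis"
  have "\<forall>n. \<exists>\<phi>\<in>\<Phi>. euc_dist I \<phi>0 \<phi> < inverse (real (Suc n)) \<and>
      H \<phi> < inverse (real (Suc n)) * (euc_dist I \<phi>0 \<phi>)\<^sup>2"
  proof (intro allI)
    fix n
    let ?d = "inverse (real (Suc n))"
    have "0 < ?d" by simp
    with neg have "\<not> (\<forall>\<phi>\<in>\<Phi>. euc_dist I \<phi>0 \<phi> < ?d \<longrightarrow> ?d * (euc_dist I \<phi>0 \<phi>)\<^sup>2 \<le> H \<phi>)"
      unfolding H_def by blast
    then show "\<exists>\<phi>\<in>\<Phi>. euc_dist I \<phi>0 \<phi> < ?d \<and> H \<phi> < ?d * (euc_dist I \<phi>0 \<phi>)\<^sup>2"
      by (simp add: not_le)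
  qed
  then obtain y where y: "\<And>n. y n \<in> \<Phi>" "\<And>n. euc_dist I \<phi>0 (y n) < inverse (real (Suc n))"
      "\<And>n. H (y n) < inverse (real (Suc n)) * (euc_dist I \<phi>0 (y n))\<^sup>2"
    by metis
  define r where "r n = euc_dist I \<phi>0 (y n)" for n
  have H_nonneg: "0 \<le> H \<phi>" for \<phi> unfolding H_def by simp
  have r_pos: "0 < r n" for n
    using y(3)[of n] H_nonneg[of "y n"] euc_dist_nonneg[of I \<phi>0 "y n"] unfolding r_def
    by (cases "euc_dist I \<phi>0 (y n) = 0") auto
  have r_lim: "r \<longlonglongrightarrow> 0"
    by (rule tendsto_sandwich[OF _ _ tendsto_const LIMSEQ_inverse_real_of_nat])
      (use y(2) r_pos in \<open>auto simp: r_def intro!: always_eventually less_imp_le\<close>)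
  have "bounded (range (\<lambda>n. (y n i - \<phi>0 i) / r n))" if "i \<in> I" for i
  proof -
    have "\<bar>(y n i - \<phi>0 i) / r n\<bar> \<le> 1" for n
      using euc_dist_ge_coordinate[OF fin that, of \<phi>0 "y n"] r_pos[of n]
      by (simp add: r_def abs_minus_commute)
    then show ?thesis by (intro boundedI[of _ 1]) auto
  qed
  then obtain s :: "nat \<Rightarrow> nat" and u where s: "strict_mono s"
    and u: "\<And>i. i \<in> I \<Longrightarrow> (\<lambda>n. (y (s n) i - \<phi>0 i) / r (s n)) \<longlonglongrightarrow> u i"
    using convergent_subsequence_finite_coordinates[OF fin, of "\<lambda>n i. (y n i - \<phi>0 i) / r n"]
    by blast
  have rs_lim: "(\<lambda>n. r (s n)) \<longlonglongrightarrow> 0" using LIMSEQ_subseq_LIMSEQ[OF r_lim s] by (simp add: comp_def)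
  have rs_nz: "r (s n) \<noteq> 0" for n using r_pos[of "s n"] by simp
  \<comment> \<open>the limit direction is again a unit vector, hence nonzero\<close>
  have u_norm: "(\<Sum>i\<in>I. (u i)\<^sup>2) = 1"
  proof -
    have "(\<Sum>i\<in>I. ((y n i - \<phi>0 i) / r n)\<^sup>2) = 1" for n
    proof -
      have "(\<Sum>i\<in>I. ((y n i - \<phi>0 i) / r n)\<^sup>2) = (euc_dist I (y n) \<phi>0)\<^sup>2 / (r n)\<^sup>2"
        by (simp add: euc_dist_squared power_divide sum_divide_distrib)
      then show ?thesis using r_pos[of n] by (simp add: r_def euc_dist_commute[of I "y n"])
    qed
    then have "(\<lambda>n. 1) \<longlonglongrightarrow> (\<Sum>i\<in>I. (u i)\<^sup>2)"
      using tendsto_sum[of I "\<lambda>i n. ((y (s n) i - \<phi>0 i) / r (s n))\<^sup>2" "\<lambda>i. (u i)\<^sup>2" sequentially]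
      by (simp add: tendsto_power u)
    then show ?thesis by (simp add: LIMSEQ_const_iff)
  qed
  define Du where "Du x = (\<Sum>i\<in>I. D i x * u i)" for x
  \<comment> \<open>squared difference quotients of the square root of the density; their integrals tend to zero\<close>
  define q where "q n x = ((sqrt (p (y (s n)) x) - sqrt (p \<phi>0 x)) / r (s n))\<^sup>2" for n x
  have [measurable]: "D i \<in> borel_measurable M" if "i \<in> I" for i using D_meas that by blast
  have [measurable]: "p \<phi>0 \<in> borel_measurable M" using p_int[OF x0] by auto
  have [measurable]: "Du \<in> borel_measurable M" unfolding Du_def by measurable
  have "AE x in M. (inverse (sqrt (p \<phi>0 x)) / 2 * Du x)\<^sup>2 = 0"
  proof (rule AE_eq_0_of_fatou[where q = q])
    show "integrable M (q n)" for n
    proof -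
      have "integrable M (\<lambda>x. (sqrt (p (y (s n)) x) - sqrt (p \<phi>0 x))\<^sup>2 / (r (s n))\<^sup>2)"
        by (intro integrable_divide sqrt_diff_squared_integrable p_int p_nonneg y(1) x0) auto
      then show ?thesis unfolding q_def power_divide .
    qed
    show "(\<lambda>n. q n x) \<longlonglongrightarrow> (inverse (sqrt (p \<phi>0 x)) / 2 * Du x)\<^sup>2" if x: "x \<in> space M" for x
    proof -
      have "(\<lambda>n. (p (y (s n)) x - p \<phi>0 x) / r (s n)) \<longlonglongrightarrow> Du x"
        unfolding Du_def
        by (rule hadamard_gradientD[OF grad[OF x], of "\<lambda>n. y (s n)"]) (use y rs_lim rs_nz u in auto)
      then have "(\<lambda>n. (sqrt (p (y (s n)) x) - sqrt (p \<phi>0 x)) / r (s n)) \<longlonglongrightarrow>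
          inverse (sqrt (p \<phi>0 x)) / 2 * Du x"
        by (rule difference_quotient_chain) (use rs_nz rs_lim p_pos[OF x] DERIV_real_sqrt in auto)
      then show ?thesis unfolding q_def by (rule tendsto_power)
    qed
    show "(\<lambda>n. \<integral>x. q n x \<partial>M) \<longlonglongrightarrow> 0"
    proof -
      have q_eq: "(\<integral>x. q n x \<partial>M) = H (y (s n)) / (r (s n))\<^sup>2" for n
        by (simp add: q_def H_def power_divide power2_commute[of "sqrt (p \<phi>0 _)"])
      have upper: "(\<integral>x. q n x \<partial>M) \<le> inverse (real (Suc (s n)))" for n
        unfolding q_eq using y(3)[of "s n"] r_pos[of "s n"] by (simp add: r_def divide_le_eq)
      have lower: "0 \<le> (\<integral>x. q n x \<partial>M)" for n by (simp add: q_def)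
      have "(\<lambda>n. inverse (real (Suc (s n)))) \<longlonglongrightarrow> 0"
        using LIMSEQ_subseq_LIMSEQ[OF LIMSEQ_inverse_real_of_nat s] by (simp add: comp_def)
      then show ?thesis
        by (rule tendsto_sandwich[OF always_eventually always_eventually tendsto_const,
            OF allI[OF lower] allI[OF upper]])
    qed
  qed (auto simp: q_def)
  then have zero: "AE x in M. (Du x)\<^sup>2 / p \<phi>0 x = 0"
  proof (rule AE_mp, intro AE_I2 impI)
    fix x assume "x \<in> space M" "(inverse (sqrt (p \<phi>0 x)) / 2 * Du x)\<^sup>2 = 0"
    then show "(Du x)\<^sup>2 / p \<phi>0 x = 0" using p_pos[of x] by simp
  qed
  have "(\<Sum>i\<in>I. \<Sum>j\<in>I. u i * (\<integral>x. D i x * D j x / p \<phi>0 x \<partial>M) * u j)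
      = (\<integral>x. (\<Sum>i\<in>I. \<Sum>j\<in>I. u i * (D i x * D j x / p \<phi>0 x) * u j) \<partial>M)"
    using info_int
    by (simp del: times_divide_eq_left times_divide_eq_right add: Bochner_Integration.integral_sum)
  also have "\<dots> = (\<integral>x. (Du x)\<^sup>2 / p \<phi>0 x \<partial>M)"
  proof (intro Bochner_Integration.integral_cong refl)
    fix x
    have "(Du x)\<^sup>2 / p \<phi>0 x = (\<Sum>i\<in>I. \<Sum>j\<in>I. (D i x * u i) * (D j x * u j) / p \<phi>0 x)"
      unfolding Du_def power2_eq_square sum_product sum_divide_distrib ..
    then show "(\<Sum>i\<in>I. \<Sum>j\<in>I. u i * (D i x * D j x / p \<phi>0 x) * u j) = (Du x)\<^sup>2 / p \<phi>0 x"
      by (simp add: mult.commute mult.left_commute)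
  qed
  also have "\<dots> = 0"
    using zero by (rule integral_eq_zero_AE)
  finally have "(\<Sum>i\<in>I. \<Sum>j\<in>I. u i * (\<integral>x. D i x * D j x / p \<phi>0 x \<partial>M) * u j) = 0" .
  moreover have "0 < (\<Sum>i\<in>I. \<Sum>j\<in>I. u i * (\<integral>x. D i x * D j x / p \<phi>0 x \<partial>M) * u j)"
  proof -
    have "\<exists>i\<in>I. u i \<noteq> 0"
    proof (rule ccontr)
      assume "\<not> ?thesis"
      then have "(\<Sum>i\<in>I. (u i)\<^sup>2) = 0" by simp
      then show False using u_norm by simp
    qed
    moreover have "\<forall>v. (\<exists>i\<in>I. v i \<noteq> 0) \<longrightarrow>
        0 < (\<Sum>i\<in>I. \<Sum>j\<in>I. v i * (\<integral>x. D i x * D j x / p \<phi>0 x \<partial>M) * v j)"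
      using posdef unfolding pos_def_on_def by (rule conjunct2)
    ultimately show ?thesis by blast
  qed
  ultimately show False by linarith
qed

section \<open>Finite mixtures of exponential components with smooth parameters\<close>

text \<open>The density, not normalised, of a curved exponential family with natural parameter \<open>\<beta>\<close>, statistic
  \<open>\<tau>\<close> and logarithmic base density \<open>b\<close>; \<open>J\<close> indexes the coordinates of the statistic.\<close>

definition exp_component ::
  "'a set \<Rightarrow> ('a \<Rightarrow> 'p \<Rightarrow> real) \<Rightarrow> ('a \<Rightarrow> 'x \<Rightarrow> real) \<Rightarrow> ('x \<Rightarrow> real) \<Rightarrow> 'p \<Rightarrow> 'x \<Rightarrow> real" where
  "exp_component J \<beta> \<tau> b \<phi> x = exp ((\<Sum>a\<in>J. \<beta> a \<phi> * \<tau> a x) + b x)"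

text \<open>The mixture weights are absorbed into the components. Beyond smoothness of the natural parameters,
  what matters is that the second moments of the statistics are finite and depend continuously on the
  parameter. The function \<open>p\<close> is prescribed on \<open>\<Phi>\<close> only, because the exponential form of a hidden
  Markov density presupposes positive weights.\<close>

locale smooth_exponential_mixture =
  fixes M :: "'x measure" and I :: "'i::countable set" and \<Phi> :: "('i \<Rightarrow> real) set"
    and S :: "'s set" and J :: "'s \<Rightarrow> 'a set"
    and \<beta> :: "'s \<Rightarrow> 'a \<Rightarrow> ('i \<Rightarrow> real) \<Rightarrow> real" and \<tau> :: "'s \<Rightarrow> 'a \<Rightarrow> 'x \<Rightarrow> real" and b :: "'s \<Rightarrow> 'x \<Rightarrow> real"
    and p :: "('i \<Rightarrow> real) \<Rightarrow> 'x \<Rightarrow> real"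
  assumes finite_I: "finite I" and open_\<Phi>: "openin (top_of_set (euc I)) \<Phi>"
    and finite_S: "finite S" and S_nonempty: "S \<noteq> {}"
    and \<tau>_measurable: "\<And>s a. s \<in> S \<Longrightarrow> a \<in> J s \<Longrightarrow> \<tau> s a \<in> borel_measurable M"
    and b_measurable: "\<And>s. s \<in> S \<Longrightarrow> b s \<in> borel_measurable M"
    and \<beta>_C1: "\<And>s a. s \<in> S \<Longrightarrow> a \<in> J s \<Longrightarrow> coord_C1 I \<Phi> (\<beta> s a)"
    and p_eq: "\<And>\<phi> x. \<phi> \<in> \<Phi> \<Longrightarrow> p \<phi> x = (\<Sum>s\<in>S. exp_component (J s) (\<beta> s) (\<tau> s) (b s) \<phi> x)"
    and component_integrable:
      "\<And>s \<phi>. s \<in> S \<Longrightarrow> \<phi> \<in> \<Phi> \<Longrightarrow> integrable M (exp_component (J s) (\<beta> s) (\<tau> s) (b s) \<phi>)"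
    and moment_integrable:
      "\<And>s \<phi>. s \<in> S \<Longrightarrow> \<phi> \<in> \<Phi> \<Longrightarrow>
         integrable M (\<lambda>x. exp_component (J s) (\<beta> s) (\<tau> s) (b s) \<phi> x * (\<Sum>a\<in>J s. (\<tau> s a x)\<^sup>2))"
    and moment_continuous:
      "\<And>s. s \<in> S \<Longrightarrow> continuous_on \<Phi>
         (\<lambda>\<phi>. \<integral>x. exp_component (J s) (\<beta> s) (\<tau> s) (b s) \<phi> x * (\<Sum>a\<in>J s. (\<tau> s a x)\<^sup>2) \<partial>M)"
begin

abbreviation component :: "'s \<Rightarrow> ('i \<Rightarrow> real) \<Rightarrow> 'x \<Rightarrow> real" where
  "component s \<equiv> exp_component (J s) (\<beta> s) (\<tau> s) (b s)"

definition \<beta>_grad :: "'s \<Rightarrow> 'a \<Rightarrow> 'i \<Rightarrow> ('i \<Rightarrow> real) \<Rightarrow> real" where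
  "\<beta>_grad s a = (SOME D. coord_C1_gradient I \<Phi> (\<beta> s a) D)"

definition score :: "'s \<Rightarrow> 'i \<Rightarrow> ('i \<Rightarrow> real) \<Rightarrow> 'x \<Rightarrow> real" where
  "score s i \<phi> x = (\<Sum>a\<in>J s. \<beta>_grad s a i \<phi> * \<tau> s a x)"

definition p_grad :: "'i \<Rightarrow> ('i \<Rightarrow> real) \<Rightarrow> 'x \<Rightarrow> real" where
  "p_grad i \<phi> x = (\<Sum>s\<in>S. component s \<phi> x * score s i \<phi> x)"

lemma \<beta>_grad:
  assumes "s \<in> S" "a \<in> J s"
  shows "coord_C1_gradient I \<Phi> (\<beta> s a) (\<beta>_grad s a)"
  unfolding \<beta>_grad_def using \<beta>_C1[OF assms] unfolding coord_C1_def by (rule someI_ex)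

lemma component_pos: "0 < component s \<phi> x"
  by (simp add: exp_component_def)

lemma p_pos: "\<phi> \<in> \<Phi> \<Longrightarrow> 0 < p \<phi> x"
  using finite_S S_nonempty component_pos by (simp add: p_eq sum_pos)

lemma p_integrable: "\<phi> \<in> \<Phi> \<Longrightarrow> integrable M (p \<phi>)"
  using component_integrable by (subst Bochner_Integration.integrable_cong[OF refl p_eq]) auto

lemma component_continuous:
  assumes "s \<in> S"
  shows "continuous_on \<Phi> (\<lambda>\<phi>. component s \<phi> x)"
  unfolding exp_component_def
  by (intro continuous_intros coord_C1_imp_continuous_on[OF \<beta>_C1] assms)

lemma score_continuous:
  assumes "s \<in> S" "i \<in> I"
  shows "continuous_on \<Phi> (\<lambda>\<phi>. score s i \<phi> x)"
  unfolding score_def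
  by (intro continuous_intros) (use \<beta>_grad assms in \<open>auto simp: coord_C1_gradient_def\<close>)

lemma p_continuous: "continuous_on \<Phi> (\<lambda>\<phi>. p \<phi> x)"
proof -
  have "continuous_on \<Phi> (\<lambda>\<phi>. \<Sum>s\<in>S. component s \<phi> x)"
    by (intro continuous_on_sum component_continuous)
  then show ?thesis by (simp add: p_eq cong: continuous_on_cong)
qed

lemma p_grad_continuous: "i \<in> I \<Longrightarrow> continuous_on \<Phi> (\<lambda>\<phi>. p_grad i \<phi> x)"
  unfolding p_grad_def by (intro continuous_intros component_continuous score_continuous)

lemma component_measurable: "s \<in> S \<Longrightarrow> component s \<phi> \<in> borel_measurable M"
  unfolding exp_component_def using \<tau>_measurable b_measurable by measurable

lemma p_grad_measurable: "p_grad i \<phi> \<in> borel_measurable M"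
  unfolding p_grad_def score_def
  by (intro borel_measurable_sum borel_measurable_times component_measurable
      borel_measurable_const \<tau>_measurable)

lemma p_hadamard_gradient:
  assumes \<phi>: "\<phi> \<in> \<Phi>"
  shows "hadamard_gradient I \<Phi> (\<lambda>\<psi>. p \<psi> x) \<phi> (\<lambda>i. p_grad i \<phi> x)"
proof -
  have "hadamard_gradient I \<Phi> (\<lambda>\<psi>. component s \<psi> x) \<phi> (\<lambda>i. component s \<phi> x * score s i \<phi> x)"
    if s: "s \<in> S" for s
    unfolding exp_component_def
  proof (rule hadamard_gradient_chain[where h = exp])
    have "hadamard_gradient I \<Phi> (\<lambda>\<psi>. \<beta> s a \<psi> * \<tau> s a x) \<phi> (\<lambda>i. \<tau> s a x * \<beta>_grad s a i \<phi>)"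
      if "a \<in> J s" for a
      by (rule hadamard_gradient_chain[where h = "\<lambda>z. z * \<tau> s a x"])
        (use \<beta>_grad[OF s that] \<phi> in \<open>auto simp: coord_C1_gradient_def intro!: derivative_eq_intros\<close>)
    from hadamard_gradient_sum[of "J s", OF this]
    have "hadamard_gradient I \<Phi> (\<lambda>\<psi>. \<Sum>a\<in>J s. \<beta> s a \<psi> * \<tau> s a x) \<phi> (\<lambda>i. score s i \<phi> x)"
      by (simp add: score_def mult.commute)
    moreover have "((\<lambda>z. z + b s x) has_real_derivative 1) (at (\<Sum>a\<in>J s. \<beta> s a \<phi> * \<tau> s a x))"
      by (auto intro!: derivative_eq_intros)
    ultimately show "hadamard_gradient I \<Phi> (\<lambda>\<psi>. (\<Sum>a\<in>J s. \<beta> s a \<psi> * \<tau> s a x) + b s x) \<phi> (\<lambda>i. score s i \<phi> x)"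
      using hadamard_gradient_chain[where h' = 1] by force
  qed (rule DERIV_exp)
  from hadamard_gradient_sum[of S, OF this]
  have "hadamard_gradient I \<Phi> (\<lambda>\<psi>. \<Sum>s\<in>S. component s \<psi> x) \<phi> (\<lambda>i. p_grad i \<phi> x)"
    by (simp add: p_grad_def)
  then show ?thesis using hadamard_gradient_cong[OF \<phi> p_eq] by simp
qed

lemma p_has_partial_derivative:
  assumes "\<phi> \<in> \<Phi>" "i \<in> I"
  shows "((\<lambda>t. p (\<phi>(i := t)) x) has_real_derivative p_grad i \<phi> x) (at (\<phi> i))"
  by (rule partial_derivative_of_hadamard_gradient[OF finite_I open_\<Phi> assms
        p_hadamard_gradient[OF assms(1)]])

lemma p_has_partial: "\<phi> \<in> \<Phi> \<Longrightarrow> i \<in> I \<Longrightarrow> has_partial (\<lambda>\<psi>. p \<psi> x) i \<phi>"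
  unfolding has_partial_def
  using p_has_partial_derivative real_differentiable_def by blast

lemma info_integrand_eq:
  assumes "\<phi> \<in> \<Phi>" "i \<in> I" "j \<in> I"
  shows "info_integrand p \<phi> i j x = p_grad i \<phi> x * p_grad j \<phi> x / p \<phi> x"
  using assms by (simp add: info_integrand_def partial_deriv_def DERIV_imp_deriv[OF p_has_partial_derivative])

text \<open>The dominating function for the diagonal of the information integrand. It separates factors that
  depend on the parameter alone from the second moments of the statistics.\<close>

definition info_envelope :: "'i \<Rightarrow> ('i \<Rightarrow> real) \<Rightarrow> 'x \<Rightarrow> real" where
  "info_envelope i \<phi> x =
     (\<Sum>s\<in>S. (\<Sum>a\<in>J s. (\<beta>_grad s a i \<phi>)\<^sup>2) * (component s \<phi> x * (\<Sum>a\<in>J s. (\<tau> s a x)\<^sup>2)))"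

text \<open>Two uses of the Cauchy-Schwarz inequality: over the components with weights \<open>component s \<phi> x\<close>, whose
  sum \<open>p \<phi> x\<close> cancels the denominator, and over the statistics inside each score.\<close>

lemma p_grad_squared_le:
  assumes \<phi>: "\<phi> \<in> \<Phi>"
  shows "(p_grad i \<phi> x)\<^sup>2 / p \<phi> x \<le> info_envelope i \<phi> x"
proof -
  have "(p_grad i \<phi> x)\<^sup>2 =
      (\<Sum>s\<in>S. sqrt (component s \<phi> x) * (sqrt (component s \<phi> x) * score s i \<phi> x))\<^sup>2"
    using component_pos by (simp add: p_grad_def less_imp_le flip: mult.assoc)
  also have "\<dots> \<le> (\<Sum>s\<in>S. (sqrt (component s \<phi> x))\<^sup>2) *
      (\<Sum>s\<in>S. (sqrt (component s \<phi> x) * score s i \<phi> x)\<^sup>2)"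
    by (rule Cauchy_Schwarz_ineq_sum)
  also have "\<dots> = p \<phi> x * (\<Sum>s\<in>S. component s \<phi> x * (score s i \<phi> x)\<^sup>2)"
    using component_pos by (simp add: p_eq[OF \<phi>] power_mult_distrib less_imp_le)
  also have "\<dots> \<le> p \<phi> x * info_envelope i \<phi> x"
  proof (intro mult_left_mono less_imp_le[OF p_pos[OF \<phi>]])
    have "component s \<phi> x * (score s i \<phi> x)\<^sup>2 \<le>
        component s \<phi> x * ((\<Sum>a\<in>J s. (\<beta>_grad s a i \<phi>)\<^sup>2) * (\<Sum>a\<in>J s. (\<tau> s a x)\<^sup>2))" for s
      unfolding score_def by (intro mult_left_mono Cauchy_Schwarz_ineq_sum less_imp_le component_pos)
    then show "(\<Sum>s\<in>S. component s \<phi> x * (score s i \<phi> x)\<^sup>2) \<le> info_envelope i \<phi> x"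
      unfolding info_envelope_def by (intro sum_mono) (simp add: mult.left_commute)
  qed
  finally show ?thesis
    using p_pos[OF \<phi>] by (simp add: divide_le_eq mult.commute)
qed

text \<open>Off-diagonal entries are reduced to diagonal ones by \<open>\<bar>u v\<bar> \<le> u\<^sup>2 + v\<^sup>2\<close>.\<close>

lemma info_integrand_le:
  assumes \<phi>: "\<phi> \<in> \<Phi>" and "i \<in> I" "j \<in> I"
  shows "\<bar>info_integrand p \<phi> i j x\<bar> \<le> info_envelope i \<phi> x + info_envelope j \<phi> x"
proof -
  let ?u = "p_grad i \<phi> x" and ?v = "p_grad j \<phi> x"
  have "\<bar>?u * ?v\<bar> \<le> ?u\<^sup>2 + ?v\<^sup>2"
    using sum_squares_bound[of "\<bar>?u\<bar>" "\<bar>?v\<bar>"] zero_le_power2[of ?u] zero_le_power2[of ?v]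
    unfolding abs_mult power2_abs by linarith
  then have "\<bar>?u * ?v\<bar> / p \<phi> x \<le> (?u\<^sup>2 + ?v\<^sup>2) / p \<phi> x"
    using p_pos[OF \<phi>] by (intro divide_right_mono) (auto intro: less_imp_le)
  then have "\<bar>?u * ?v / p \<phi> x\<bar> \<le> ?u\<^sup>2 / p \<phi> x + ?v\<^sup>2 / p \<phi> x"
    using p_pos[OF \<phi>, of x] by (simp add: add_divide_distrib abs_divide)
  also have "\<dots> \<le> info_envelope i \<phi> x + info_envelope j \<phi> x"
    by (intro add_mono p_grad_squared_le \<phi>)
  finally show ?thesis using assms by (simp add: info_integrand_eq)
qed

lemma info_envelope_integrable: "\<phi> \<in> \<Phi> \<Longrightarrow> integrable M (info_envelope i \<phi>)"
  unfolding info_envelope_def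
  by (intro Bochner_Integration.integrable_sum integrable_mult_right moment_integrable)

lemma info_envelope_continuous:
  assumes "i \<in> I"
  shows "continuous_on \<Phi> (\<lambda>\<phi>. info_envelope i \<phi> x)"
  unfolding info_envelope_def
  by (intro continuous_intros component_continuous)
    (use \<beta>_grad assms in \<open>auto simp: coord_C1_gradient_def\<close>)

lemma integral_info_envelope_continuous:
  assumes "i \<in> I"
  shows "continuous_on \<Phi> (\<lambda>\<phi>. \<integral>x. info_envelope i \<phi> x \<partial>M)"
proof -
  have "continuous_on \<Phi> (\<lambda>\<phi>. \<Sum>s\<in>S. (\<Sum>a\<in>J s. (\<beta>_grad s a i \<phi>)\<^sup>2) *
      (\<integral>x. component s \<phi> x * (\<Sum>a\<in>J s. (\<tau> s a x)\<^sup>2) \<partial>M))"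
    by (intro continuous_on_sum continuous_on_mult continuous_on_power moment_continuous)
      (use \<beta>_grad assms in \<open>auto simp: coord_C1_gradient_def\<close>)
  moreover have "(\<integral>x. info_envelope i \<phi> x \<partial>M) = (\<Sum>s\<in>S. (\<Sum>a\<in>J s. (\<beta>_grad s a i \<phi>)\<^sup>2) *
      (\<integral>x. component s \<phi> x * (\<Sum>a\<in>J s. (\<tau> s a x)\<^sup>2) \<partial>M))" if "\<phi> \<in> \<Phi>" for \<phi>
    unfolding info_envelope_def
    by (subst Bochner_Integration.integral_sum)
      (auto intro!: integrable_mult_right moment_integrable that)
  ultimately show ?thesis by (simp cong: continuous_on_cong)
qed

lemma info_integrand_measurable:
  assumes "\<phi> \<in> \<Phi>" "i \<in> I" "j \<in> I"
  shows "info_integrand p \<phi> i j \<in> borel_measurable M"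
proof -
  have "(\<lambda>x. p_grad i \<phi> x * p_grad j \<phi> x / p \<phi> x) \<in> borel_measurable M"
    by (intro borel_measurable_divide borel_measurable_times p_grad_measurable
        borel_measurable_integrable p_integrable assms)
  then show ?thesis by (simp add: info_integrand_eq[OF assms, abs_def])
qed

theorem info_integrand_integrable:
  assumes "\<phi> \<in> \<Phi>" "i \<in> I" "j \<in> I"
  shows "integrable M (info_integrand p \<phi> i j)"
proof (rule Bochner_Integration.integrable_bound)
  show "integrable M (\<lambda>x. info_envelope i \<phi> x + info_envelope j \<phi> x)"
    by (intro Bochner_Integration.integrable_add info_envelope_integrable assms)
  show "AE x in M. norm (info_integrand p \<phi> i j x) \<le> norm (info_envelope i \<phi> x + info_envelope j \<phi> x)"
    using info_integrand_le[OF assms] by (intro AE_I2) (smt (verit) real_norm_def)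
qed (rule info_integrand_measurable[OF assms])

text \<open>The envelopes and their integrals both converge along every convergent sequence of parameters.\<close>

theorem information_continuous:
  assumes ij: "i \<in> I" "j \<in> I"
  shows "continuous_on \<Phi> (\<lambda>\<phi>. information M p \<phi> i j)"
proof (rule continuous_on_sequentiallyI)
  fix y \<phi> assume y: "\<forall>n. y n \<in> \<Phi>" and \<phi>: "\<phi> \<in> \<Phi>" and lim: "y \<longlonglongrightarrow> \<phi>"
  have seq: "(\<lambda>n. h (y n)) \<longlonglongrightarrow> h \<phi>" if "continuous_on \<Phi> h" for h :: "('i \<Rightarrow> real) \<Rightarrow> real"
    using continuous_on_tendsto_compose[OF that lim \<phi>] y by simp
  show "(\<lambda>n. information M p (y n) i j) \<longlonglongrightarrow> information M p \<phi> i j"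
    unfolding information_def
  proof (rule integral_tendsto_dominated_by_convergent)
    fix x
    show "\<bar>info_integrand p (y n) i j x\<bar> \<le> info_envelope i (y n) x + info_envelope j (y n) x" for n
      using info_integrand_le y ij by blast
    have "continuous_on \<Phi> (\<lambda>\<phi>. info_integrand p \<phi> i j x)"
    proof -
      have "continuous_on \<Phi> (\<lambda>\<phi>. p_grad i \<phi> x * p_grad j \<phi> x / p \<phi> x)"
        by (intro continuous_on_divide continuous_on_mult p_grad_continuous p_continuous ij ballI less_imp_neq[THEN not_sym] p_pos)
      then show ?thesis by (simp add: info_integrand_eq ij cong: continuous_on_cong)
    qed
    then show "(\<lambda>n. info_integrand p (y n) i j x) \<longlonglongrightarrow> info_integrand p \<phi> i j x" by (rule seq)
    show "(\<lambda>n. info_envelope i (y n) x + info_envelope j (y n) x)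
        \<longlonglongrightarrow> info_envelope i \<phi> x + info_envelope j \<phi> x"
      by (intro tendsto_add seq info_envelope_continuous ij)
  next
    have "(\<lambda>n. (\<integral>x. info_envelope i (y n) x \<partial>M) + (\<integral>x. info_envelope j (y n) x \<partial>M))
        \<longlonglongrightarrow> (\<integral>x. info_envelope i \<phi> x \<partial>M) + (\<integral>x. info_envelope j \<phi> x \<partial>M)"
      by (intro tendsto_add seq integral_info_envelope_continuous ij)
    then show "(\<lambda>n. \<integral>x. info_envelope i (y n) x + info_envelope j (y n) x \<partial>M)
        \<longlonglongrightarrow> (\<integral>x. info_envelope i \<phi> x + info_envelope j \<phi> x \<partial>M)"
      using y \<phi> by (simp add: Bochner_Integration.integral_add info_envelope_integrable)
  qed (use y \<phi> ij in \<open>auto intro!: info_integrand_measurable info_envelope_integrable\<close>)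
qed

theorem hellinger_quadratic_lower_bound:
  assumes M: "sigma_finite_measure M" and \<phi>0: "\<phi>0 \<in> \<Phi>"
    and posdef: "pos_def_on I (information M p \<phi>0)"
  shows "\<exists>\<delta>>0. \<exists>c>0. \<forall>\<phi>\<in>\<Phi>. euc_dist I \<phi>0 \<phi> < \<delta> \<longrightarrow>
           c * (euc_dist I \<phi>0 \<phi>)\<^sup>2 \<le> (hellinger M (density M (p \<phi>0)) (density M (p \<phi>)))\<^sup>2"
proof -
  have h: "(hellinger M (density M (p \<phi>0)) (density M (p \<phi>)))\<^sup>2
      = 1 / 2 * (\<integral>x. (sqrt (p \<phi>0 x) - sqrt (p \<phi> x))\<^sup>2 \<partial>M)" if "\<phi> \<in> \<Phi>" for \<phi>
    by (rule hellinger_squared_density[OF M])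
      (use that \<phi>0 p_pos in \<open>auto intro: borel_measurable_integrable p_integrable less_imp_le\<close>)
  have "\<exists>\<delta>>0. \<exists>c>0. \<forall>\<phi>\<in>\<Phi>. euc_dist I \<phi>0 \<phi> < \<delta> \<longrightarrow>
           c * (euc_dist I \<phi>0 \<phi>)\<^sup>2 \<le> (\<integral>x. (sqrt (p \<phi>0 x) - sqrt (p \<phi> x))\<^sup>2 \<partial>M)"
  proof (rule quadratic_lower_bound_sqrt_density[OF finite_I \<phi>0])
    show "hadamard_gradient I \<Phi> (\<lambda>\<phi>. p \<phi> x) \<phi>0 (\<lambda>i. p_grad i \<phi>0 x)" for x
      by (rule p_hadamard_gradient[OF \<phi>0])
    show "integrable M (\<lambda>x. p_grad i \<phi>0 x * p_grad j \<phi>0 x / p \<phi>0 x)" if "i \<in> I" "j \<in> I" for i j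
      using info_integrand_integrable[OF \<phi>0 that] by (simp add: info_integrand_eq[OF \<phi>0 that, abs_def])
    have "information M p \<phi>0 i j = (\<integral>x. p_grad i \<phi>0 x * p_grad j \<phi>0 x / p \<phi>0 x \<partial>M)"
      if "i \<in> I" "j \<in> I" for i j
      using that by (simp add: information_def info_integrand_eq \<phi>0)
    then show "pos_def_on I (\<lambda>i j. \<integral>x. p_grad i \<phi>0 x * p_grad j \<phi>0 x / p \<phi>0 x \<partial>M)"
      using posdef by (simp add: pos_def_on_def cong: sum.cong)
  qed (use p_integrable p_pos \<phi>0 p_grad_measurable in \<open>auto intro: less_imp_le\<close>)
  then obtain \<delta> c where "0 < \<delta>" "0 < c" and c: "\<And>\<phi>. \<phi> \<in> \<Phi> \<Longrightarrow> euc_dist I \<phi>0 \<phi> < \<delta> \<Longrightarrow>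
           c * (euc_dist I \<phi>0 \<phi>)\<^sup>2 \<le> (\<integral>x. (sqrt (p \<phi>0 x) - sqrt (p \<phi> x))\<^sup>2 \<partial>M)"
    by blast
  have "c / 2 * (euc_dist I \<phi>0 \<phi>)\<^sup>2 \<le> (hellinger M (density M (p \<phi>0)) (density M (p \<phi>)))\<^sup>2"
    if "\<phi> \<in> \<Phi>" "euc_dist I \<phi>0 \<phi> < \<delta>" for \<phi>
    using c[OF that] h[OF that(1)] by simp
  with \<open>0 < \<delta>\<close> \<open>0 < c\<close> show ?thesis by (meson half_gt_zero)
qed

end

section \<open>Hidden Markov models with exponential family emissions\<close>

lemma complete_prob_bounds:
  assumes a: "(\<lambda>j\<in>{..<K - 1}. a j) \<in> open_simplex K" and k: "k < K"
  shows "0 < complete_prob K a k" "complete_prob K a k \<le> 1"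
proof -
  have a01: "0 < a j \<and> a j < 1" if "j < K - 1" for j
    using a that by (auto simp: open_simplex_def PiE_def Pi_def)
  have "(\<Sum>j<K - 1. a j) < 1" using a by (simp add: open_simplex_def)
  moreover have "0 \<le> (\<Sum>j<K - 1. a j)" using a01 by (intro sum_nonneg) (auto intro: less_imp_le)
  ultimately show "0 < complete_prob K a k" "complete_prob K a k \<le> 1"
    using a01[of k] by (auto simp: complete_prob_def)
qed

lemma coord_C1_complete_prob:
  assumes "\<And>j. j < K - 1 \<Longrightarrow> coord_C1 I S (\<lambda>\<phi>. a \<phi> j)"
  shows "coord_C1 I S (\<lambda>\<phi>. complete_prob K (a \<phi>) k)"
proof (cases "k < K - 1")
  case True
  then show ?thesis using assms by (simp add: complete_prob_def)
next
  case False
  have "coord_C1 I S (\<lambda>\<phi>. 1 + (- 1) * (\<Sum>j<K - 1. a \<phi> j))"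
    by (intro coord_C1_add coord_C1_const coord_C1_cmult coord_C1_sum assms) simp
  then show ?thesis using False by (simp add: complete_prob_def)
qed

text \<open>The model, with names for the derived objects. \<open>K > 0\<close> makes the set of paths nonempty, and
  \<open>L > 0\<close> puts the initial state of a path among the \<open>K\<close> states.\<close>

locale exponential_family_hmm =
  fixes K L :: nat
    and d e :: "nat \<Rightarrow> nat"
    and \<nu> :: "'a measure"
    and \<Theta> :: "nat \<Rightarrow> (nat \<Rightarrow> real) set"
    and \<eta> :: "nat \<Rightarrow> (nat \<Rightarrow> real) \<Rightarrow> nat \<Rightarrow> real"
    and T :: "nat \<Rightarrow> 'a \<Rightarrow> nat \<Rightarrow> real"
    and B :: "nat \<Rightarrow> 'a \<Rightarrow> real"
    and \<Phi> :: "(hmm_coord \<Rightarrow> real) set"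
    and A :: "nat \<Rightarrow> (nat \<Rightarrow> real) \<Rightarrow> real"
    and f :: "nat \<Rightarrow> (nat \<Rightarrow> real) \<Rightarrow> 'a \<Rightarrow> real"
    and I :: "hmm_coord set"
    and \<nu>L :: "(nat \<Rightarrow> 'a) measure"
    and p :: "(hmm_coord \<Rightarrow> real) \<Rightarrow> (nat \<Rightarrow> 'a) \<Rightarrow> real"
  assumes A_def: "A = (\<lambda>k. expfam_A \<nu> (d k) (\<eta> k) (T k) (B k))"
    and f_def: "f = (\<lambda>k. expfam_density \<nu> (d k) (\<eta> k) (T k) (B k))"
    and I_def: "I = hmm_coords K e"
    and \<nu>L_def: "\<nu>L = Pi\<^sub>M {..<L} (\<lambda>_. \<nu>)"
    and p_def: "p = hmm_density K L e f"
    and K_pos: "0 < K" and L_pos: "0 < L"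
    and sigma_finite: "sigma_finite_measure \<nu>"
    and \<Theta>_sub: "\<And>k. k < K \<Longrightarrow> \<Theta> k \<subseteq> euc {..<e k}"
    and T_measurable: "\<And>k j. k < K \<Longrightarrow> j < d k \<Longrightarrow> (\<lambda>x. T k x j) \<in> borel_measurable \<nu>"
    and B_measurable: "\<And>k. k < K \<Longrightarrow> B k \<in> borel_measurable \<nu>"
    and kernel_integrable: "\<And>k \<theta>. k < K \<Longrightarrow> \<theta> \<in> \<Theta> k \<Longrightarrow>
           integrable \<nu> (expfam_kernel (d k) (\<eta> k) (T k) (B k) \<theta>)"
    and \<Phi>_sub: "\<Phi> \<subseteq> hmm_params K e \<Theta>"
    and \<Phi>_open: "openin (top_of_set (euc I)) \<Phi>"
    and \<eta>_C1: "\<And>k j. k < K \<Longrightarrow> j < d k \<Longrightarrow> euc_C1_on {..<e k} (\<Theta> k) (\<lambda>\<theta>. \<eta> k \<theta> j)"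
    and A_C1: "\<And>k. k < K \<Longrightarrow> euc_C1_on {..<e k} (\<Theta> k) (A k)"
    and T_moment: "\<And>k \<theta>. k < K \<Longrightarrow> \<theta> \<in> \<Theta> k \<Longrightarrow>
           integrable \<nu> (\<lambda>x. (L2_set (T k x) {..<d k})\<^sup>2 * f k \<theta> x)"
    and T_moment_continuous: "\<And>k \<theta>. k < K \<Longrightarrow> \<theta> \<in> \<Theta> k \<Longrightarrow>
           ((\<lambda>\<theta>'. \<integral>x. (L2_set (T k x) {..<d k})\<^sup>2 * \<bar>f k \<theta> x - f k \<theta>' x\<bar> \<partial>\<nu>) \<longlongrightarrow> 0)
             (at \<theta> within \<Theta> k)"
begin

lemma finite_I: "finite I"
proof -
  have "I = Wt ` {..<K - 1} \<union> case_prod Tr ` ({..<K} \<times> {..<K - 1})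
      \<union> case_prod Th ` (SIGMA k:{..<K}. {..<e k})"
    unfolding I_def hmm_coords_def by (auto simp: image_iff)
  then show ?thesis by simp
qed

lemma coord_in_I:
  "j < K - 1 \<Longrightarrow> Wt j \<in> I"
  "k < K \<Longrightarrow> j < K - 1 \<Longrightarrow> Tr k j \<in> I"
  "k < K \<Longrightarrow> j < e k \<Longrightarrow> Th k j \<in> I"
  by (auto simp: I_def hmm_coords_def)

lemma hmm_theta_in: "\<phi> \<in> \<Phi> \<Longrightarrow> k < K \<Longrightarrow> hmm_theta e \<phi> k \<in> \<Theta> k"
  using \<Phi>_sub by (auto simp: hmm_params_def)

lemma hmm_w_bounds:
  assumes "\<phi> \<in> \<Phi>" "k < K"
  shows "0 < hmm_w K \<phi> k" "hmm_w K \<phi> k \<le> 1"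
  unfolding hmm_w_def
  by (rule complete_prob_bounds; use assms \<Phi>_sub in \<open>force simp: hmm_params_def\<close>)+

lemma hmm_Q_bounds:
  assumes "\<phi> \<in> \<Phi>" "i < K" "k < K"
  shows "0 < hmm_Q K \<phi> i k" "hmm_Q K \<phi> i k \<le> 1"
  unfolding hmm_Q_def
  by (rule complete_prob_bounds; use assms \<Phi>_sub in \<open>force simp: hmm_params_def\<close>)+

lemma hmm_w_C1: "coord_C1 I \<Phi> (\<lambda>\<phi>. hmm_w K \<phi> k)"
  unfolding hmm_w_def by (intro coord_C1_complete_prob coord_C1_coordinate finite_I coord_in_I)

lemma hmm_Q_C1: "i < K \<Longrightarrow> coord_C1 I \<Phi> (\<lambda>\<phi>. hmm_Q K \<phi> i k)"
  unfolding hmm_Q_def by (intro coord_C1_complete_prob coord_C1_coordinate finite_I coord_in_I)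

lemma hmm_theta_C1:
  assumes k: "k < K" and g: "euc_C1_on {..<e k} (\<Theta> k) g"
  shows "coord_C1 I \<Phi> (\<lambda>\<phi>. g (hmm_theta e \<phi> k))"
  unfolding hmm_theta_def
proof (rule coord_C1_pullback[OF finite_I])
  show "Th k ` {..<e k} \<subseteq> I" using k coord_in_I by auto
  show "(\<lambda>j\<in>{..<e k}. \<phi> (Th k j)) \<in> \<Theta> k" if "\<phi> \<in> \<Phi>" for \<phi>
    using hmm_theta_in[OF that k] by (simp add: hmm_theta_def)
  show "coord_C1 {..<e k} (\<Theta> k) g"
    by (rule coord_C1_of_euc_C1_on[OF _ \<Theta>_sub[OF k] g]) simp
qed

lemma hmm_theta_continuous: "continuous_on S (\<lambda>\<phi>. hmm_theta e \<phi> k)"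
proof (rule continuous_on_coordinatewise_then_product)
  show "continuous_on S (\<lambda>\<phi>. hmm_theta e \<phi> k j)" for j
    unfolding hmm_theta_def by (cases "j < e k") (auto intro: continuous_on_coordinate)
qed

text \<open>The common total mass of all emission densities. It is \<open>1\<close>, except that for \<open>\<nu> = 0\<close> the
  convention \<open>ln 0 = 0\<close> makes the density equal to the kernel, with integral \<open>0\<close>. In both cases it does
  not depend on the parameter.\<close>

definition mass :: real where
  "mass = (if emeasure \<nu> (space \<nu>) = 0 then 0 else 1)"

lemma f_eq: "f k \<theta> x = exp (A k \<theta>) * expfam_kernel (d k) (\<eta> k) (T k) (B k) \<theta> x"
  by (simp add: f_def A_def expfam_density_def expfam_kernel_def exp_add mult.commute mult.left_commute)

lemma f_integrable: "k < K \<Longrightarrow> \<theta> \<in> \<Theta> k \<Longrightarrow> integrable \<nu> (f k \<theta>)"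
  unfolding f_eq[abs_def] by (intro integrable_mult_right kernel_integrable)

lemma integral_f:
  assumes "k < K" "\<theta> \<in> \<Theta> k"
  shows "(\<integral>x. f k \<theta> x \<partial>\<nu>) = mass"
proof -
  define g where "g = expfam_kernel (d k) (\<eta> k) (T k) (B k) \<theta>"
  have g: "integrable \<nu> g" "\<And>x. 0 < g x"
    using kernel_integrable[OF assms] by (simp_all add: g_def expfam_kernel_def)
  have eq: "(\<integral>x. f k \<theta> x \<partial>\<nu>) = exp (A k \<theta>) * (\<integral>x. g x \<partial>\<nu>)"
    by (simp add: f_eq g_def)
  have A: "A k \<theta> = - ln (\<integral>x. g x \<partial>\<nu>)" by (simp add: A_def expfam_A_def g_def)
  have zero: "(\<integral>x. g x \<partial>\<nu>) = 0 \<longleftrightarrow> emeasure \<nu> (space \<nu>) = 0"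
  proof -
    have "(\<integral>x. g x \<partial>\<nu>) = 0 \<longleftrightarrow> (AE x in \<nu>. g x = 0)"
      using g by (intro integral_nonneg_eq_0_iff_AE) (auto intro: less_imp_le)
    also have "\<dots> \<longleftrightarrow> (AE x in \<nu>. False)"
      by (intro AE_cong) (use g(2) in \<open>simp add: less_imp_neq[THEN not_sym]\<close>)
    also have "\<dots> \<longleftrightarrow> emeasure \<nu> (space \<nu>) = 0"
      by (subst AE_iff_measurable[OF sets.top]) auto
    finally show ?thesis .
  qed
  have "0 \<le> (\<integral>x. g x \<partial>\<nu>)" using g(2) by (intro Bochner_Integration.integral_nonneg) (simp add: less_imp_le)
  then show ?thesis
    unfolding eq A mass_def using zero
    by (cases "(\<integral>x. g x \<partial>\<nu>) = 0") (auto simp: exp_minus)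
qed

abbreviation T_norm2 :: "nat \<Rightarrow> 'a \<Rightarrow> real" where
  "T_norm2 k x \<equiv> (L2_set (T k x) {..<d k})\<^sup>2"

text \<open>The difference of two such moments is at most the integral in the continuity hypothesis.\<close>

lemma integral_T_norm2_continuous:
  assumes k: "k < K"
  shows "continuous_on (\<Theta> k) (\<lambda>\<theta>. \<integral>x. T_norm2 k x * f k \<theta> x \<partial>\<nu>)"
  unfolding continuous_on_def
proof
  fix \<theta> assume \<theta>: "\<theta> \<in> \<Theta> k"
  have bound: "norm ((\<integral>x. T_norm2 k x * f k \<theta>' x \<partial>\<nu>) - (\<integral>x. T_norm2 k x * f k \<theta> x \<partial>\<nu>))
      \<le> (\<integral>x. T_norm2 k x * \<bar>f k \<theta> x - f k \<theta>' x\<bar> \<partial>\<nu>)" if \<theta>': "\<theta>' \<in> \<Theta> k" for \<theta>'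
  proof -
    have "norm ((\<integral>x. T_norm2 k x * f k \<theta>' x \<partial>\<nu>) - (\<integral>x. T_norm2 k x * f k \<theta> x \<partial>\<nu>))
        = norm (\<integral>x. T_norm2 k x * f k \<theta>' x - T_norm2 k x * f k \<theta> x \<partial>\<nu>)"
      by (subst Bochner_Integration.integral_diff[OF T_moment[OF k \<theta>'] T_moment[OF k \<theta>]]) (rule refl)
    also have "\<dots> \<le> (\<integral>x. norm (T_norm2 k x * f k \<theta>' x - T_norm2 k x * f k \<theta> x) \<partial>\<nu>)"
      by (rule integral_norm_bound)
    also have "\<dots> = (\<integral>x. T_norm2 k x * \<bar>f k \<theta> x - f k \<theta>' x\<bar> \<partial>\<nu>)"
      by (simp add: abs_mult abs_minus_commute flip: right_diff_distrib)
    finally show ?thesis .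
  qed
  have "((\<lambda>\<theta>'. (\<integral>x. T_norm2 k x * f k \<theta>' x \<partial>\<nu>) - (\<integral>x. T_norm2 k x * f k \<theta> x \<partial>\<nu>)) \<longlongrightarrow> 0)
      (at \<theta> within \<Theta> k)"
    by (rule Lim_null_comparison[OF _ T_moment_continuous[OF k \<theta>]])
      (use bound in \<open>auto simp: eventually_at_filter intro!: always_eventually\<close>)
  then show "((\<lambda>\<theta>'. \<integral>x. T_norm2 k x * f k \<theta>' x \<partial>\<nu>) \<longlongrightarrow> (\<integral>x. T_norm2 k x * f k \<theta> x \<partial>\<nu>))
      (at \<theta> within \<Theta> k)"
    by (rule Lim_null[THEN iffD2])
qed

definition paths :: "(nat \<Rightarrow> nat) set" where
  "paths = {..<L} \<rightarrow>\<^sub>E {..<K}"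

text \<open>The statistics of a path: \<open>None\<close> stands for the constant statistic \<open>1\<close>, which carries everything in
  the logarithm of the path density that depends on the parameter alone, and \<open>Some (l, m)\<close> for the
  \<open>m\<close>-th coordinate of the statistic of the \<open>l\<close>-th observation.\<close>

definition stat_index :: "(nat \<Rightarrow> nat) \<Rightarrow> (nat \<times> nat) option set" where
  "stat_index s = insert None (Some ` (SIGMA l:{..<L}. {..<d (s l)}))"

definition path_param :: "(nat \<Rightarrow> nat) \<Rightarrow> (nat \<times> nat) option \<Rightarrow> (hmm_coord \<Rightarrow> real) \<Rightarrow> real" where
  "path_param s a \<phi> = (case a of
      None \<Rightarrow> ln (hmm_w K \<phi> (s 0)) + (\<Sum>l<L - 1. ln (hmm_Q K \<phi> (s l) (s (Suc l))))
              + (\<Sum>l<L. A (s l) (hmm_theta e \<phi> (s l)))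
    | Some (l, m) \<Rightarrow> \<eta> (s l) (hmm_theta e \<phi> (s l)) m)"

definition path_stat :: "(nat \<Rightarrow> nat) \<Rightarrow> (nat \<times> nat) option \<Rightarrow> (nat \<Rightarrow> 'a) \<Rightarrow> real" where
  "path_stat s a x = (case a of None \<Rightarrow> 1 | Some (l, m) \<Rightarrow> T (s l) (x l) m)"

definition path_base :: "(nat \<Rightarrow> nat) \<Rightarrow> (nat \<Rightarrow> 'a) \<Rightarrow> real" where
  "path_base s x = (\<Sum>l<L. B (s l) (x l))"

definition path_weight :: "(nat \<Rightarrow> nat) \<Rightarrow> (hmm_coord \<Rightarrow> real) \<Rightarrow> real" where
  "path_weight s \<phi> = hmm_w K \<phi> (s 0) * (\<Prod>l<L - 1. hmm_Q K \<phi> (s l) (s (Suc l)))"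

lemma path_state: "s \<in> paths \<Longrightarrow> l < L \<Longrightarrow> s l < K"
  by (auto simp: paths_def)

lemma sum_stat_index:
  fixes g :: "_ \<Rightarrow> real"
  shows "(\<Sum>a\<in>stat_index s. g a) = g None + (\<Sum>l<L. \<Sum>m<d (s l). g (Some (l, m)))"
proof -
  have "(\<Sum>a\<in>Some ` (SIGMA l:{..<L}. {..<d (s l)}). g a) = (\<Sum>l<L. \<Sum>m<d (s l). g (Some (l, m)))"
    by (simp add: sum.reindex sum.Sigma split_def)
  moreover have "None \<notin> Some ` (SIGMA l:{..<L}. {..<d (s l)})" by blast
  ultimately show ?thesis unfolding stat_index_def by simp
qed

text \<open>The weights \<open>w\<close> and \<open>Q\<close> are positive on the parameter set, so each is the exponential of its
  logarithm.\<close>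

lemma path_component_eq:
  assumes \<phi>: "\<phi> \<in> \<Phi>" and s: "s \<in> paths"
  shows "exp_component (stat_index s) (path_param s) (path_stat s) (path_base s) \<phi> x
    = path_weight s \<phi> * (\<Prod>l<L. f (s l) (hmm_theta e \<phi> (s l)) (x l))"
proof -
  let ?t = "\<lambda>l. hmm_theta e \<phi> (s l)"
  have "(\<Sum>a\<in>stat_index s. path_param s a \<phi> * path_stat s a x) + path_base s x =
      ln (hmm_w K \<phi> (s 0)) + (\<Sum>l<L - 1. ln (hmm_Q K \<phi> (s l) (s (Suc l)))) +
      (\<Sum>l<L. (\<Sum>m<d (s l). \<eta> (s l) (?t l) m * T (s l) (x l) m) + A (s l) (?t l) + B (s l) (x l))"
    by (simp add: sum_stat_index path_param_def path_stat_def path_base_def sum.distrib)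
  moreover have "exp (ln (hmm_w K \<phi> (s 0))) = hmm_w K \<phi> (s 0)"
    using hmm_w_bounds[OF \<phi> path_state[OF s L_pos]] by simp
  moreover have "exp (\<Sum>l<L - 1. ln (hmm_Q K \<phi> (s l) (s (Suc l))))
      = (\<Prod>l<L - 1. hmm_Q K \<phi> (s l) (s (Suc l)))"
    unfolding exp_sum[OF finite_lessThan]
    by (intro prod.cong refl exp_ln hmm_Q_bounds \<phi> path_state[OF s]) auto
  moreover have "exp (\<Sum>l<L. (\<Sum>m<d (s l). \<eta> (s l) (?t l) m * T (s l) (x l) m)
      + A (s l) (?t l) + B (s l) (x l)) = (\<Prod>l<L. f (s l) (?t l) (x l))"
    unfolding exp_sum[OF finite_lessThan] by (simp add: f_def A_def expfam_density_def)
  ultimately show ?thesis unfolding exp_component_def path_weight_def by (simp add: exp_add)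
qed

lemma p_eq_mixture:
  assumes "\<phi> \<in> \<Phi>"
  shows "p \<phi> x = (\<Sum>s\<in>paths. exp_component (stat_index s) (path_param s) (path_stat s) (path_base s) \<phi> x)"
  using path_component_eq[OF assms] by (simp add: p_def hmm_density_def path_weight_def paths_def)

lemma path_param_C1:
  assumes s: "s \<in> paths" and a: "a \<in> stat_index s"
  shows "coord_C1 I \<Phi> (path_param s a)"
proof (cases a)
  case None
  have "coord_C1 I \<Phi> (\<lambda>\<phi>. ln (hmm_w K \<phi> (s 0)))"
    by (intro coord_C1_ln hmm_w_C1 hmm_w_bounds path_state[OF s] L_pos)
  moreover have "coord_C1 I \<Phi> (\<lambda>\<phi>. \<Sum>l<L - 1. ln (hmm_Q K \<phi> (s l) (s (Suc l))))"
    by (intro coord_C1_sum coord_C1_ln hmm_Q_C1 hmm_Q_bounds path_state[OF s]) auto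
  moreover have "coord_C1 I \<Phi> (\<lambda>\<phi>. \<Sum>l<L. A (s l) (hmm_theta e \<phi> (s l)))"
    by (intro coord_C1_sum hmm_theta_C1 A_C1 path_state[OF s]) auto
  ultimately show ?thesis unfolding path_param_def None by (simp add: coord_C1_add)
next
  case (Some lm)
  then obtain l m where lm: "a = Some (l, m)" "l < L" "m < d (s l)"
    using a unfolding stat_index_def by auto
  show ?thesis
    unfolding path_param_def lm(1) using hmm_theta_C1[OF path_state[OF s lm(2)] \<eta>_C1]
      path_state[OF s lm(2)] lm(3) by simp
qed

lemma component_measurable_comp:
  assumes "l < L" "h \<in> borel_measurable \<nu>"
  shows "(\<lambda>x. h (x l) :: real) \<in> borel_measurable \<nu>L"
proof -
  have "(\<lambda>x. x l) \<in> measurable \<nu>L \<nu>"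
    unfolding \<nu>L_def using measurable_component_singleton[of l "{..<L}" "\<lambda>_. \<nu>"] assms(1) by simp
  then show ?thesis using assms(2) by (rule measurable_compose)
qed

lemma product_sigma_finite: "product_sigma_finite (\<lambda>_::nat. \<nu>)"
  unfolding product_sigma_finite_def using sigma_finite by simp

lemma sigma_finite_\<nu>L: "sigma_finite_measure \<nu>L"
  unfolding \<nu>L_def by (rule product_sigma_finite.sigma_finite[OF product_sigma_finite]) simp

text \<open>Fubini: attaching the squared statistic to the \<open>l\<close>-th factor of the product leaves a product of
  functions of single observations.\<close>

lemma path_second_moment:
  assumes \<phi>: "\<phi> \<in> \<Phi>" and s: "s \<in> paths" and l: "l < L"
  shows "integrable \<nu>L (\<lambda>x. T_norm2 (s l) (x l) * (\<Prod>j<L. f (s j) (hmm_theta e \<phi> (s j)) (x j)))"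
    and "(\<integral>x. T_norm2 (s l) (x l) * (\<Prod>j<L. f (s j) (hmm_theta e \<phi> (s j)) (x j)) \<partial>\<nu>L)
      = (\<integral>y. T_norm2 (s l) y * f (s l) (hmm_theta e \<phi> (s l)) y \<partial>\<nu>) * mass ^ (L - 1)"
proof -
  interpret product_sigma_finite "\<lambda>_::nat. \<nu>" by (rule product_sigma_finite)
  \<comment> \<open>the product density with the squared statistic absorbed into its factor number \<open>l\<close>\<close>
  define h where "h j y = (if j = l then T_norm2 (s j) y else 1) * f (s j) (hmm_theta e \<phi> (s j)) y" for j y
  have h_prod: "T_norm2 (s l) (x l) * (\<Prod>j<L. f (s j) (hmm_theta e \<phi> (s j)) (x j)) = (\<Prod>j<L. h j (x j))" for x
    using l by (simp add: h_def prod.distrib prod.delta)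
  have \<theta>: "hmm_theta e \<phi> (s j) \<in> \<Theta> (s j)" if "j < L" for j
    by (rule hmm_theta_in[OF \<phi> path_state[OF s that]])
  have h_int: "integrable \<nu> (h j)" if "j < L" for j
    using T_moment[OF path_state[OF s that] \<theta>[OF that]] f_integrable[OF path_state[OF s that] \<theta>[OF that]]
    by (cases "j = l") (simp_all add: h_def[abs_def])
  show "integrable \<nu>L (\<lambda>x. T_norm2 (s l) (x l) * (\<Prod>j<L. f (s j) (hmm_theta e \<phi> (s j)) (x j)))"
    unfolding h_prod \<nu>L_def by (rule product_integrable_prod) (use h_int in auto)
  have "(\<integral>x. (\<Prod>j<L. h j (x j)) \<partial>\<nu>L) = (\<Prod>j<L. integral\<^sup>L \<nu> (h j))"
    unfolding \<nu>L_def by (rule product_integral_prod) (use h_int in auto)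
  also have "\<dots> = integral\<^sup>L \<nu> (h l) * (\<Prod>j\<in>{..<L} - {l}. integral\<^sup>L \<nu> (h j))"
    using l by (simp add: prod.remove)
  also have "(\<Prod>j\<in>{..<L} - {l}. integral\<^sup>L \<nu> (h j)) = (\<Prod>j\<in>{..<L} - {l}. mass)"
    by (intro prod.cong refl) (use integral_f[OF path_state[OF s] \<theta>] in \<open>simp add: h_def[abs_def]\<close>)
  also have "\<dots> = mass ^ (L - 1)" using l by simp
  finally show "(\<integral>x. T_norm2 (s l) (x l) * (\<Prod>j<L. f (s j) (hmm_theta e \<phi> (s j)) (x j)) \<partial>\<nu>L)
      = (\<integral>y. T_norm2 (s l) y * f (s l) (hmm_theta e \<phi> (s l)) y \<partial>\<nu>) * mass ^ (L - 1)"
    by (simp add: h_prod h_def)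
qed

lemma path_mass:
  assumes \<phi>: "\<phi> \<in> \<Phi>" and s: "s \<in> paths"
  shows "integrable \<nu>L (\<lambda>x. \<Prod>j<L. f (s j) (hmm_theta e \<phi> (s j)) (x j))"
    and "(\<integral>x. (\<Prod>j<L. f (s j) (hmm_theta e \<phi> (s j)) (x j)) \<partial>\<nu>L) = mass ^ L"
proof -
  interpret product_sigma_finite "\<lambda>_::nat. \<nu>" by (rule product_sigma_finite)
  have int: "integrable \<nu> (f (s j) (hmm_theta e \<phi> (s j)))" if "j < L" for j
    by (intro f_integrable hmm_theta_in \<phi> path_state[OF s] that)
  show "integrable \<nu>L (\<lambda>x. \<Prod>j<L. f (s j) (hmm_theta e \<phi> (s j)) (x j))"
    unfolding \<nu>L_def by (rule product_integrable_prod) (use int in auto)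
  have "(\<integral>x. (\<Prod>j<L. f (s j) (hmm_theta e \<phi> (s j)) (x j)) \<partial>\<nu>L)
      = (\<Prod>j<L. \<integral>y. f (s j) (hmm_theta e \<phi> (s j)) y \<partial>\<nu>)"
    unfolding \<nu>L_def by (rule product_integral_prod) (use int in auto)
  also have "\<dots> = (\<Prod>j<L. mass)"
    by (intro prod.cong refl integral_f hmm_theta_in \<phi> path_state[OF s]) auto
  finally show "(\<integral>x. (\<Prod>j<L. f (s j) (hmm_theta e \<phi> (s j)) (x j)) \<partial>\<nu>L) = mass ^ L" by simp
qed

lemma path_moment_expand:
  assumes \<phi>: "\<phi> \<in> \<Phi>" and s: "s \<in> paths"
  shows "exp_component (stat_index s) (path_param s) (path_stat s) (path_base s) \<phi> x
      * (\<Sum>a\<in>stat_index s. (path_stat s a x)\<^sup>2)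
    = path_weight s \<phi> * ((\<Prod>j<L. f (s j) (hmm_theta e \<phi> (s j)) (x j))
      + (\<Sum>l<L. T_norm2 (s l) (x l) * (\<Prod>j<L. f (s j) (hmm_theta e \<phi> (s j)) (x j))))"
proof -
  have "(\<Sum>a\<in>stat_index s. (path_stat s a x)\<^sup>2) = 1 + (\<Sum>l<L. T_norm2 (s l) (x l))"
    by (simp add: sum_stat_index path_stat_def L2_set_def sum_nonneg)
  then show ?thesis
    unfolding path_component_eq[OF assms] by (simp add: algebra_simps sum_distrib_left)
qed

lemma path_weight_continuous:
  assumes s: "s \<in> paths"
  shows "continuous_on \<Phi> (path_weight s)"
  unfolding path_weight_def
  by (intro continuous_on_mult continuous_on_prod coord_C1_imp_continuous_on[OF hmm_w_C1]
      coord_C1_imp_continuous_on[OF hmm_Q_C1] path_state[OF s]) auto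

sublocale smooth_exponential_mixture \<nu>L I \<Phi> paths stat_index path_param path_stat path_base p
proof
  show "finite I" by (rule finite_I)
  show "openin (top_of_set (euc I)) \<Phi>" by (rule \<Phi>_open)
  show "finite paths" unfolding paths_def by (intro finite_PiE) auto
  show "paths \<noteq> {}" unfolding paths_def using K_pos by (auto simp: PiE_eq_empty_iff)
  fix s assume s: "s \<in> paths"
  show "path_base s \<in> borel_measurable \<nu>L"
    unfolding path_base_def
    by (intro borel_measurable_sum component_measurable_comp B_measurable path_state[OF s]) auto
  show "path_stat s a \<in> borel_measurable \<nu>L" if "a \<in> stat_index s" for a
    using that unfolding stat_index_def path_stat_def
    by (auto intro!: component_measurable_comp[where h = "\<lambda>y. T _ y _"] T_measurable path_state[OF s])
  show "coord_C1 I \<Phi> (path_param s a)" if "a \<in> stat_index s" for a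
    by (rule path_param_C1[OF s that])
  let ?c = "exp_component (stat_index s) (path_param s) (path_stat s) (path_base s)"
  show "integrable \<nu>L (?c \<phi>)" if "\<phi> \<in> \<Phi>" for \<phi>
    using path_mass(1)[OF that s] by (simp add: path_component_eq[OF that s, abs_def])
  show "integrable \<nu>L (\<lambda>x. ?c \<phi> x * (\<Sum>a\<in>stat_index s. (path_stat s a x)\<^sup>2))" if "\<phi> \<in> \<Phi>" for \<phi>
    unfolding path_moment_expand[OF that s]
    by (intro integrable_mult_right Bochner_Integration.integrable_add Bochner_Integration.integrable_sum
        path_mass path_second_moment that s) simp
  have "(\<integral>x. ?c \<phi> x * (\<Sum>a\<in>stat_index s. (path_stat s a x)\<^sup>2) \<partial>\<nu>L) = path_weight s \<phi> * (mass ^ L +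
      (\<Sum>l<L. (\<integral>y. T_norm2 (s l) y * f (s l) (hmm_theta e \<phi> (s l)) y \<partial>\<nu>) * mass ^ (L - 1)))"
    if \<phi>: "\<phi> \<in> \<Phi>" for \<phi>
  proof -
    let ?f = "\<lambda>x. \<Prod>j<L. f (s j) (hmm_theta e \<phi> (s j)) (x j)"
    have "(\<integral>x. ?f x + (\<Sum>l<L. T_norm2 (s l) (x l) * ?f x) \<partial>\<nu>L)
        = (\<integral>x. ?f x \<partial>\<nu>L) + (\<Sum>l<L. \<integral>x. T_norm2 (s l) (x l) * ?f x \<partial>\<nu>L)"
      by (subst Bochner_Integration.integral_add, rule path_mass(1)[OF \<phi> s],
          rule Bochner_Integration.integrable_sum, rule path_second_moment(1)[OF \<phi> s], simp,
          subst Bochner_Integration.integral_sum, rule path_second_moment(1)[OF \<phi> s]) auto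
    then show ?thesis
      unfolding path_moment_expand[OF \<phi> s] by (simp add: path_mass(2)[OF \<phi> s] path_second_moment(2)[OF \<phi> s])
  qed
  moreover have "continuous_on \<Phi> (\<lambda>\<phi>. path_weight s \<phi> * (mass ^ L +
      (\<Sum>l<L. (\<integral>y. T_norm2 (s l) y * f (s l) (hmm_theta e \<phi> (s l)) y \<partial>\<nu>) * mass ^ (L - 1))))"
  proof (intro continuous_on_mult continuous_on_add continuous_on_sum continuous_on_const
      path_weight_continuous s)
    fix l assume "l \<in> {..<L}"
    then have k: "s l < K" using path_state[OF s] by simp
    show "continuous_on \<Phi> (\<lambda>\<phi>. \<integral>y. T_norm2 (s l) y * f (s l) (hmm_theta e \<phi> (s l)) y \<partial>\<nu>)"
      by (rule continuous_on_compose2[OF integral_T_norm2_continuous[OF k] hmm_theta_continuous])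
        (use hmm_theta_in k in auto)
  qed
  ultimately show "continuous_on \<Phi> (\<lambda>\<phi>. \<integral>x. ?c \<phi> x * (\<Sum>a\<in>stat_index s. (path_stat s a x)\<^sup>2) \<partial>\<nu>L)"
    by (simp cong: continuous_on_cong)
qed (rule p_eq_mixture)

end

section \<open>Comparing the parameter loss with the Hellinger distance\<close>

text \<open>The last entry is \<open>1\<close> minus the sum of the others, so its error is a sum of at most \<open>K\<close> terms; the
  Cauchy-Schwarz inequality yields the factor \<open>K\<close>.\<close>

lemma complete_prob_diff_squared_le:
  assumes "k < K"
  shows "(complete_prob K a k - complete_prob K b k)\<^sup>2 \<le> K * (\<Sum>j<K - 1. (a j - b j)\<^sup>2)"
proof (cases "k < K - 1")
  case True
  have "(a k - b k)\<^sup>2 \<le> (\<Sum>j<K - 1. (a j - b j)\<^sup>2)"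
    using True by (intro member_le_sum) auto
  also have "\<dots> \<le> K * (\<Sum>j<K - 1. (a j - b j)\<^sup>2)"
    using assms mult_right_mono[of 1 "real K" "\<Sum>j<K - 1. (a j - b j)\<^sup>2"] by (simp add: sum_nonneg)
  finally show ?thesis using True by (simp add: complete_prob_def)
next
  case False
  have "(complete_prob K a k - complete_prob K b k)\<^sup>2 = (\<Sum>j<K - 1. 1 * (a j - b j))\<^sup>2"
    using False by (simp add: complete_prob_def sum_subtractf power2_commute)
  also have "\<dots> \<le> (\<Sum>j<K - 1. 1\<^sup>2) * (\<Sum>j<K - 1. (a j - b j)\<^sup>2)"
    by (rule Cauchy_Schwarz_ineq_sum)
  also have "\<dots> \<le> K * (\<Sum>j<K - 1. (a j - b j)\<^sup>2)"
    by (intro mult_right_mono) (auto simp: sum_nonneg)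
  finally show ?thesis .
qed

lemma sum_coords_le_euc_dist_squared:
  assumes "finite I" "inj_on \<iota> J" "\<iota> ` J \<subseteq> I"
  shows "(\<Sum>j\<in>J. (x (\<iota> j) - y (\<iota> j))\<^sup>2) \<le> (euc_dist I x y)\<^sup>2"
proof -
  have "(\<Sum>j\<in>J. (x (\<iota> j) - y (\<iota> j))\<^sup>2) = (\<Sum>i\<in>\<iota> ` J. (x i - y i)\<^sup>2)"
    by (simp add: sum.reindex[OF assms(2)])
  also have "\<dots> \<le> (\<Sum>i\<in>I. (x i - y i)\<^sup>2)"
    by (rule sum_mono2) (use assms in auto)
  finally show ?thesis by (simp add: euc_dist_squared)
qed

lemma unit_interval_diff_squared_le_1:
  fixes u v :: real
  assumes "0 < u" "u \<le> 1" "0 < v" "v \<le> 1"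
  shows "(u - v)\<^sup>2 \<le> 1"
  using assms by (simp add: abs_square_le_1 abs_le_iff)

context exponential_family_hmm
begin

definition loss :: "(hmm_coord \<Rightarrow> real) \<Rightarrow> (hmm_coord \<Rightarrow> real) \<Rightarrow> real" where
  "loss \<phi> \<psi> = (\<Sum>k<K. (hmm_w K \<phi> k - hmm_w K \<psi> k)\<^sup>2)
     + (\<Sum>k<K. \<Sum>j<K. (hmm_Q K \<phi> k j - hmm_Q K \<psi> k j)\<^sup>2)
     + (\<Sum>k<K. min ((euc_dist {..<e k} (hmm_theta e \<phi> k) (hmm_theta e \<psi> k))\<^sup>2) 1)"

lemma loss_le:
  assumes w: "\<And>k. k < K \<Longrightarrow> (hmm_w K \<phi> k - hmm_w K \<psi> k)\<^sup>2 \<le> W"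
    and Q: "\<And>k j. k < K \<Longrightarrow> j < K \<Longrightarrow> (hmm_Q K \<phi> k j - hmm_Q K \<psi> k j)\<^sup>2 \<le> W"
    and \<theta>: "\<And>k. k < K \<Longrightarrow> min ((euc_dist {..<e k} (hmm_theta e \<phi> k) (hmm_theta e \<psi> k))\<^sup>2) 1 \<le> W"
  shows "loss \<phi> \<psi> \<le> (real K + real K * real K + real K) * W"
proof -
  have "(\<Sum>k<K. (hmm_w K \<phi> k - hmm_w K \<psi> k)\<^sup>2) \<le> real (card {..<K}) * W"
    by (rule sum_bounded_above) (use w in auto)
  moreover have "(\<Sum>k<K. \<Sum>j<K. (hmm_Q K \<phi> k j - hmm_Q K \<psi> k j)\<^sup>2)
      \<le> real (card {..<K}) * (real (card {..<K}) * W)"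
    by (intro sum_bounded_above) (use Q in auto)
  moreover have "(\<Sum>k<K. min ((euc_dist {..<e k} (hmm_theta e \<phi> k) (hmm_theta e \<psi> k))\<^sup>2) 1)
      \<le> real (card {..<K}) * W"
    by (rule sum_bounded_above) (use \<theta> in auto)
  ultimately show ?thesis unfolding loss_def by (simp add: algebra_simps)
qed

text \<open>Apart from the last entries of the probability vectors, which the other entries control, the
  quantities compared on the left are coordinates of the parameters.\<close>

lemma loss_le_euc_dist:
  "loss \<phi> \<psi> \<le> (real K + real K * real K + real K) * (real K * (euc_dist I \<phi> \<psi>)\<^sup>2)"
proof (rule loss_le)
  let ?D = "(euc_dist I \<phi> \<psi>)\<^sup>2"
  show "(hmm_w K \<phi> k - hmm_w K \<psi> k)\<^sup>2 \<le> K * ?D" if "k < K" for k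
  proof -
    have "(\<Sum>j<K - 1. (\<phi> (Wt j) - \<psi> (Wt j))\<^sup>2) \<le> ?D"
      by (rule sum_coords_le_euc_dist_squared[OF finite_I]) (auto simp: inj_on_def coord_in_I)
    then show ?thesis
      unfolding hmm_w_def
      by (intro order_trans[OF complete_prob_diff_squared_le[OF that]] mult_left_mono) auto
  qed
  show "(hmm_Q K \<phi> k j - hmm_Q K \<psi> k j)\<^sup>2 \<le> K * ?D" if "k < K" "j < K" for k j
  proof -
    have "(\<Sum>j<K - 1. (\<phi> (Tr k j) - \<psi> (Tr k j))\<^sup>2) \<le> ?D"
      by (rule sum_coords_le_euc_dist_squared[OF finite_I]) (use that in \<open>auto simp: inj_on_def coord_in_I\<close>)
    then show ?thesis
      unfolding hmm_Q_def
      by (intro order_trans[OF complete_prob_diff_squared_le[OF that(2)]] mult_left_mono) auto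
  qed
  show "min ((euc_dist {..<e k} (hmm_theta e \<phi> k) (hmm_theta e \<psi> k))\<^sup>2) 1 \<le> K * ?D" if "k < K" for k
  proof -
    have "(euc_dist {..<e k} (hmm_theta e \<phi> k) (hmm_theta e \<psi> k))\<^sup>2
        = (\<Sum>j<e k. (\<phi> (Th k j) - \<psi> (Th k j))\<^sup>2)"
      unfolding euc_dist_squared by (intro sum.cong) (auto simp: hmm_theta_def)
    also have "\<dots> \<le> ?D"
      by (rule sum_coords_le_euc_dist_squared[OF finite_I]) (use that in \<open>auto simp: inj_on_def coord_in_I\<close>)
    also have "\<dots> \<le> K * ?D"
      using K_pos by (intro mult_le_cancel_right1[THEN iffD2]) auto
    finally show ?thesis by simp
  qed
qed

lemma loss_bounded:
  assumes "\<phi> \<in> \<Phi>" "\<psi> \<in> \<Phi>"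
  shows "loss \<phi> \<psi> \<le> (real K + real K * real K + real K) * 1"
  by (rule loss_le) (auto intro!: unit_interval_diff_squared_le_1 hmm_w_bounds hmm_Q_bounds assms)

text \<open>Within distance \<open>\<delta>\<close> of \<open>\<phi>0\<close> both sides are compared with the squared distance of the parameters,
  beyond it with positive constants.\<close>

theorem loss_le_hellinger:
  assumes \<phi>0: "\<phi>0 \<in> regular_params I \<nu>L p \<Phi>"
  shows "\<exists>C>0. \<forall>\<phi>\<in>\<Phi>. C * loss \<phi>0 \<phi> \<le> (hellinger \<nu>L (density \<nu>L (p \<phi>0)) (density \<nu>L (p \<phi>)))\<^sup>2"
proof -
  define h2 where "h2 \<phi> = (hellinger \<nu>L (density \<nu>L (p \<phi>0)) (density \<nu>L (p \<phi>)))\<^sup>2" for \<phi>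
  have \<phi>0_in: "\<phi>0 \<in> \<Phi>" and posdef: "pos_def_on I (information \<nu>L p \<phi>0)"
    and far: "\<And>a. 0 < a \<Longrightarrow> 0 < (INF \<psi>\<in>{\<psi> \<in> \<Phi>. a \<le> euc_dist I \<phi>0 \<psi>}. ereal (h2 \<psi>))"
    using \<phi>0 unfolding regular_params_def h2_def by auto
  obtain \<delta> c where \<delta>: "0 < \<delta>" and c: "0 < c"
    and near: "\<And>\<phi>. \<phi> \<in> \<Phi> \<Longrightarrow> euc_dist I \<phi>0 \<phi> < \<delta> \<Longrightarrow> c * (euc_dist I \<phi>0 \<phi>)\<^sup>2 \<le> h2 \<phi>"
    using hellinger_quadratic_lower_bound[OF sigma_finite_\<nu>L \<phi>0_in posdef] unfolding h2_def by blast
  \<comment> \<open>the infimum may be infinite, so a real number below it is chosen\<close>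
  obtain m where m: "0 < m" and m_far: "\<And>\<phi>. \<phi> \<in> \<Phi> \<Longrightarrow> \<delta> \<le> euc_dist I \<phi>0 \<phi> \<Longrightarrow> m \<le> h2 \<phi>"
  proof -
    obtain m where "0 < ereal m" and m: "ereal m < (INF \<psi>\<in>{\<psi> \<in> \<Phi>. \<delta> \<le> euc_dist I \<phi>0 \<psi>}. ereal (h2 \<psi>))"
      using ereal_dense2[OF far[OF \<delta>]] by (auto simp: zero_ereal_def)
    have "m \<le> h2 \<phi>" if "\<phi> \<in> \<Phi>" "\<delta> \<le> euc_dist I \<phi>0 \<phi>" for \<phi>
    proof -
      have "(INF \<psi>\<in>{\<psi> \<in> \<Phi>. \<delta> \<le> euc_dist I \<phi>0 \<psi>}. ereal (h2 \<psi>)) \<le> ereal (h2 \<phi>)"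
        by (rule INF_lower) (use that in simp)
      then have "ereal m \<le> ereal (h2 \<phi>)" using m by (meson less_imp_le order_trans)
      then show ?thesis by simp
    qed
    with \<open>0 < ereal m\<close> that show thesis by simp
  qed
  define N where "N = real K + real K * real K + real K"
  have N: "0 < N" using K_pos unfolding N_def by (intro add_pos_pos) auto
  \<comment> \<open>the factors \<open>N\<close> and \<open>real K\<close> undo the constants in the two upper bounds for the loss\<close>
  define C where "C = min (c / real K) m / N"
  have C_pos: "0 < C" using c m N K_pos by (simp add: C_def)
  have scale: "C * l \<le> z" if "l \<le> N * v" "min (c / real K) m * v \<le> z" for l v z
  proof -
    have "C * l \<le> C * (N * v)" using that(1) C_pos by (intro mult_left_mono) auto
    then show ?thesis using that(2) N by (simp add: C_def)
  qed
  have "C * loss \<phi>0 \<phi> \<le> h2 \<phi>" if \<phi>: "\<phi> \<in> \<Phi>" for \<phi>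
  proof (cases "euc_dist I \<phi>0 \<phi> < \<delta>")
    case True
    show ?thesis
    proof (rule scale[OF loss_le_euc_dist[folded N_def]])
      have "min (c / real K) m * (real K * (euc_dist I \<phi>0 \<phi>)\<^sup>2)
          \<le> c / real K * (real K * (euc_dist I \<phi>0 \<phi>)\<^sup>2)"
        by (intro mult_right_mono) auto
      then show "min (c / real K) m * (real K * (euc_dist I \<phi>0 \<phi>)\<^sup>2) \<le> h2 \<phi>"
        using near[OF \<phi> True] K_pos by simp
    qed
  next
    case False
    show ?thesis
      by (rule scale[OF loss_bounded[OF \<phi>0_in \<phi>, folded N_def]]) (use m_far[OF \<phi>] False in simp)
  qed
  with C_pos show ?thesis unfolding h2_def by blast
qed

end

theorem proposition2:
  fixes K L :: nat
    and d e :: "nat \<Rightarrow> nat"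
    and \<nu> :: "'a measure"
    and \<Theta> :: "nat \<Rightarrow> (nat \<Rightarrow> real) set"
    and \<eta> :: "nat \<Rightarrow> (nat \<Rightarrow> real) \<Rightarrow> nat \<Rightarrow> real"
    and T :: "nat \<Rightarrow> 'a \<Rightarrow> nat \<Rightarrow> real"
    and B :: "nat \<Rightarrow> 'a \<Rightarrow> real"
    and \<Phi> :: "(hmm_coord \<Rightarrow> real) set"
  defines "A \<equiv> \<lambda>k. expfam_A \<nu> (d k) (\<eta> k) (T k) (B k)"
    and "f \<equiv> \<lambda>k. expfam_density \<nu> (d k) (\<eta> k) (T k) (B k)"
  defines "F \<equiv> \<lambda>k \<theta>. density \<nu> (f k \<theta>)"
    and "I \<equiv> hmm_coords K e"
    and "\<nu>L \<equiv> Pi\<^sub>M {..<L} (\<lambda>_. \<nu>)"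
    and "p \<equiv> hmm_density K L e f"
  defines "P \<equiv> \<lambda>\<phi>. density \<nu>L (p \<phi>)"
  assumes K: "K \<ge> 2" and L: "L \<ge> 2"
    and \<nu>: "sigma_finite_measure \<nu>"
    and \<Theta>: "\<And>k. k < K \<Longrightarrow> \<Theta> k \<subseteq> euc {..<e k}"
    and T_meas: "\<And>k j. k < K \<Longrightarrow> j < d k \<Longrightarrow> (\<lambda>x. T k x j) \<in> borel_measurable \<nu>"
    and B_meas: "\<And>k. k < K \<Longrightarrow> B k \<in> borel_measurable \<nu>"
    and integrable: "\<And>k \<theta>. k < K \<Longrightarrow> \<theta> \<in> \<Theta> k \<Longrightarrow>
           integrable \<nu> (expfam_kernel (d k) (\<eta> k) (T k) (B k) \<theta>)"
    and dense: "\<And>k. k < K \<Longrightarrow> \<exists>D\<subseteq>\<Theta> k. countable D \<and>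
           (\<forall>\<theta>\<in>\<Theta> k. \<forall>\<epsilon>>0. \<exists>\<theta>'\<in>D. hellinger \<nu> (F k \<theta>) (F k \<theta>') < \<epsilon>)"
    and \<Phi>_sub: "\<Phi> \<subseteq> hmm_params K e \<Theta>"
    and \<Phi>_open: "openin (top_of_set (euc I)) \<Phi>"
    and \<Phi>_convex: "euc_convex I \<Phi>"
    and a: "\<And>k \<theta>. k < K \<Longrightarrow> \<theta> \<in> \<Theta> k \<Longrightarrow>
           ((\<lambda>\<theta>'. hellinger \<nu> (F k \<theta>) (F k \<theta>')) \<longlongrightarrow> 0) (at \<theta> within \<Theta> k)"
    and b_eta: "\<And>k j. k < K \<Longrightarrow> j < d k \<Longrightarrow> euc_C1_on {..<e k} (\<Theta> k) (\<lambda>\<theta>. \<eta> k \<theta> j)"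
    and b_A: "\<And>k. k < K \<Longrightarrow> euc_C1_on {..<e k} (\<Theta> k) (A k)"
    and c_moment: "\<And>k \<theta>. k < K \<Longrightarrow> \<theta> \<in> \<Theta> k \<Longrightarrow>
           integrable \<nu> (\<lambda>x. (L2_set (T k x) {..<d k})\<^sup>2 * f k \<theta> x)"
    and c_cont: "\<And>k \<theta>. k < K \<Longrightarrow> \<theta> \<in> \<Theta> k \<Longrightarrow>
           ((\<lambda>\<theta>'. \<integral>x. (L2_set (T k x) {..<d k})\<^sup>2 * \<bar>f k \<theta> x - f k \<theta>' x\<bar> \<partial>\<nu>) \<longlongrightarrow> 0)
             (at \<theta> within \<Theta> k)"
  shows "(\<forall>\<phi>\<in>\<Phi>. \<forall>x\<in>space \<nu>L.
            p \<phi> x > 0 \<and> (\<forall>i\<in>I. has_partial (\<lambda>\<psi>. p \<psi> x) i \<phi>)) \<and>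
         (\<forall>\<phi>\<in>\<Phi>. \<forall>i\<in>I. \<forall>j\<in>I. integrable \<nu>L (info_integrand p \<phi> i j)) \<and>
         (\<forall>i\<in>I. \<forall>j\<in>I. continuous_on \<Phi> (\<lambda>\<phi>. information \<nu>L p \<phi> i j)) \<and>
         (\<forall>\<phi>'\<in>regular_params I \<nu>L p \<Phi>. \<exists>C>0. \<forall>\<phi>\<in>\<Phi>.
            C * ((\<Sum>k<K. (hmm_w K \<phi>' k - hmm_w K \<phi> k)\<^sup>2)
                 + (\<Sum>k<K. \<Sum>j<K. (hmm_Q K \<phi>' k j - hmm_Q K \<phi> k j)\<^sup>2)
                 + (\<Sum>k<K. min ((euc_dist {..<e k} (hmm_theta e \<phi>' k) (hmm_theta e \<phi> k))\<^sup>2) 1))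
            \<le> (hellinger \<nu>L (P \<phi>') (P \<phi>))\<^sup>2)"
proof -
  interpret exponential_family_hmm K L d e \<nu> \<Theta> \<eta> T B \<Phi> A f I \<nu>L p
    by (rule exponential_family_hmm.intro)
      (use K L \<nu> \<Theta> T_meas B_meas integrable \<Phi>_sub \<Phi>_open b_eta b_A c_moment c_cont
       in \<open>simp_all add: A_def f_def I_def \<nu>L_def p_def\<close>)
  show ?thesis
  proof (intro conjI ballI)
    show "0 < p \<phi> x" if "\<phi> \<in> \<Phi>" for \<phi> x using that by (rule p_pos)
    show "has_partial (\<lambda>\<psi>. p \<psi> x) i \<phi>" if "\<phi> \<in> \<Phi>" "i \<in> I" for \<phi> x i
      using that by (rule p_has_partial)
    show "Bochner_Integration.integrable \<nu>L (info_integrand p \<phi> i j)"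
      if "\<phi> \<in> \<Phi>" "i \<in> I" "j \<in> I" for \<phi> i j
      using that by (rule info_integrand_integrable)
    show "continuous_on \<Phi> (\<lambda>\<phi>. information \<nu>L p \<phi> i j)" if "i \<in> I" "j \<in> I" for i j
      using that by (rule information_continuous)
  qed (use loss_le_hellinger in \<open>simp add: P_def loss_def\<close>)
qed

end
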